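(* Let $B=\{B_s\}_{s\ge 0}$ be a one-dimensional standard Brownian motion and fix $t>0$. Then \[ \{\mathcal{T}(B)(s)\}_{0\le s\le t}\ \stackrel{(d)}{=}\ \{B_s\}_{0\le s\le t}, \] where explicitly \[ \mathcal{T}(B)(s)=B_s-\log\Bigl\{1+\frac{A_s}{A_t}\bigl(e^{2B_t}-1\bigr)\Bigr\},\qquad A_s=\int_0^s e^{2B_u}\,du . \]
   Context: For $\phi\in C([0,t];\mathbb{R})$ let $A_s(\phi)=\int_0^s e^{2\phi_u}\,du$. For $z\in\mathbb{R}$ define the path transformation $\mathbb{T}_z=\mathbb{T}^t_z$ on $C([0,t];\mathbb{R})$ by $\mathbb{T}_z(\phi)(s)=\phi_s-\log\{1+\frac{A_s(\phi)}{A_t(\phi)}(e^z-1)\}$, $0\le s\le t$, and define $\mathcal{T}=\mathcal{T}^t$ by $\mathcal{T}(\phi)(s)=\mathbb{T}_{2\phi_t}(\phi)(s)$, $0\le s\le t$. $\stackrel{(d)}{=}$ denotes equality in law (of processes). *)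

theory Defs
  imports "HOL-Probability.Probability"
begin

definition std_BM :: "'a measure \<Rightarrow> (real \<Rightarrow> 'a \<Rightarrow> real) \<Rightarrow> bool" where
  "std_BM M B \<longleftrightarrow>
     prob_space M \<and>
     (\<forall>s\<ge>0. B s \<in> borel_measurable M) \<and>
     (\<forall>\<omega>\<in>space M. B 0 \<omega> = 0 \<and> continuous_on {0..} (\<lambda>s. B s \<omega>)) \<and>
     (\<forall>s u. 0 \<le> s \<and> s < u \<longrightarrow>
        distributed M lborel (\<lambda>\<omega>. B u \<omega> - B s \<omega>) (normal_density 0 (sqrt (u - s)))) \<and>
     (\<forall>ts. sorted ts \<and> distinct ts \<and> (\<forall>x\<in>set ts. 0 \<le> x) \<longrightarrow>
        prob_space.indep_vars M (\<lambda>_. borel)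
          (\<lambda>i \<omega>. B (ts ! Suc i) \<omega> - B (ts ! i) \<omega>) {..<length ts - 1})"

definition A_fun :: "(real \<Rightarrow> real) \<Rightarrow> real \<Rightarrow> real" where
  "A_fun \<phi> s = integral {0..s} (\<lambda>u. exp (2 * \<phi> u))"

definition bbT :: "real \<Rightarrow> real \<Rightarrow> (real \<Rightarrow> real) \<Rightarrow> real \<Rightarrow> real" where
  "bbT t z \<phi> s = \<phi> s - ln (1 + A_fun \<phi> s / A_fun \<phi> t * (exp z - 1))"

definition calT :: "real \<Rightarrow> (real \<Rightarrow> real) \<Rightarrow> real \<Rightarrow> real" where
  "calT t \<phi> s = bbT t (2 * \<phi> t) \<phi> s"

definition fdd_eq :: "'a measure \<Rightarrow> (real \<Rightarrow> 'a \<Rightarrow> real) \<Rightarrow> 'b measure \<Rightarrow> (real \<Rightarrow> 'b \<Rightarrow> real)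
    \<Rightarrow> real set \<Rightarrow> bool" where
  "fdd_eq M X N Y I \<longleftrightarrow>
     (\<forall>ts. set ts \<subseteq> I \<longrightarrow>
        distr M (\<Pi>\<^sub>M i\<in>{..<length ts}. borel) (\<lambda>\<omega>. \<lambda>i\<in>{..<length ts}. X (ts ! i) \<omega>) =
        distr N (\<Pi>\<^sub>M i\<in>{..<length ts}. borel) (\<lambda>\<omega>. \<lambda>i\<in>{..<length ts}. Y (ts ! i) \<omega>))"

end

theory Submission
  imports Defs
begin

text \<open>
  The transformation fixes the path \<open>Z_s = exp (- \<phi>_s) * A_s\<close>, \<open>0 \<le> s \<le> t\<close>, and maps \<open>\<phi>_t\<close> to
  \<open>- \<phi>_t\<close>; given \<open>Z\<close>, the law of \<open>B_t\<close> is symmetric. There is a discretisation for which this is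
  exact and elementary. On the grid of mesh \<open>h = t / n\<close>, replace \<open>A\<close> by the sum
  \<open>a_k = h * (\<Sum>j\<le>k. exp (\<phi>_j + \<phi>_{j-1}))\<close>. Then \<open>Z_k = exp (- \<phi>_k) * a_k\<close> satisfies
  \<open>ln Z_{k+1} = \<phi>_k + ln (h + Z_k * exp (- \<phi>_{k+1}))\<close>, so passing from \<open>\<phi>\<close> to the coordinates
  \<open>ln Z\<close> and \<open>\<phi>_n\<close> is a composition of shears and the discrete transformation preserves Lebesgue
  measure. It also preserves the sum of the \<open>cosh (\<phi>_k - \<phi>_{k-1})\<close>, which equals a function
  of \<open>Z\<close> plus \<open>h * cosh \<phi>_n / Z_n\<close>. Hence a random walk whose increments have density
  proportional to \<open>exp (- cosh x / h)\<close> is exactly invariant. Its density \<open>D\<close> relative to the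
  Gaussian walk satisfies \<open>E D\<^sup>2 \<le> (1 + 420 * h\<^sup>2) ^ n\<close>, which tends to 1, and the
  discrete transforms converge pathwise to the continuous one.
\<close>

section \<open>The discrete transformation\<close>

definition prev :: "(nat \<Rightarrow> real) \<Rightarrow> nat \<Rightarrow> real" where
  "prev v k = (if k = 0 then 0 else v (k - 1))"

text \<open>Discrete version of \<^term>\<open>A_fun\<close>. The integrand \<open>exp (2 * \<phi>)\<close> is sampled by the
  geometric mean over each grid cell: with this choice \<open>a \<mapsto> a / (1 + c * a)\<close> describes the
  effect of the transformation on \<open>dA\<close> exactly, see \<open>dA_dT\<close>. Index \<open>k\<close> is the grid
  time \<open>(k + 1) * h\<close>; the starting value 0 of the path is not stored.\<close>

definition dA :: "real \<Rightarrow> (nat \<Rightarrow> real) \<Rightarrow> nat \<Rightarrow> real" where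
  "dA h v k = h * (\<Sum>j\<le>k. exp (v j + prev v j))"

definition dZ :: "real \<Rightarrow> (nat \<Rightarrow> real) \<Rightarrow> nat \<Rightarrow> real" where
  "dZ h v k = exp (- v k) * dA h v k"

text \<open>The parameter \<open>c\<close> of the map \<open>a / (1 + c * a)\<close>, chosen so that
  \<open>1 + c * a\<close> equals \<open>exp (2 * v (n - 1))\<close> at the last index; subtracting
  its logarithm there flips the sign of the last position.\<close>

definition dc :: "nat \<Rightarrow> real \<Rightarrow> (nat \<Rightarrow> real) \<Rightarrow> real" where
  "dc n h v = (exp (2 * v (n - 1)) - 1) / dA h v (n - 1)"

text \<open>Restricted to \<open>{..<n}\<close> so that values lie in the space of the product
  measure over \<open>{..<n}\<close>.\<close>

definition dT :: "nat \<Rightarrow> real \<Rightarrow> (nat \<Rightarrow> real) \<Rightarrow> nat \<Rightarrow> real" where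
  "dT n h v = (\<lambda>k\<in>{..<n}. v k - ln (1 + dA h v k * dc n h v))"

text \<open>The energy of the path: the walk with step density proportional to
  \<open>exp (- cosh x / h)\<close> has joint density proportional to
  \<open>exp (- dE v (n - 1) / h)\<close>.\<close>

definition dE :: "(nat \<Rightarrow> real) \<Rightarrow> nat \<Rightarrow> real" where
  "dE v k = (\<Sum>j\<le>k. cosh (v j - prev v j))"

lemma prev_simps [simp]: "prev v 0 = 0" "prev v (Suc k) = v k"
  by (auto simp: prev_def)

lemma dA_0: "dA h v 0 = h * exp (v 0)"
  by (simp add: dA_def)

lemma dA_Suc: "dA h v (Suc k) = dA h v k + h * exp (v k + v (Suc k))"
  by (simp add: dA_def algebra_simps)

lemma dA_pos: "h > 0 \<Longrightarrow> dA h v k > 0"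
  unfolding dA_def by (intro mult_pos_pos sum_pos) auto

lemma dA_mono: "h > 0 \<Longrightarrow> i \<le> k \<Longrightarrow> dA h v i \<le> dA h v k"
  unfolding dA_def by (intro mult_left_mono sum_mono2) auto

lemma dZ_pos: "h > 0 \<Longrightarrow> dZ h v k > 0"
  by (simp add: dZ_def dA_pos)

lemma dZ_0: "dZ h v 0 = h"
  by (simp add: dZ_def dA_0 exp_minus)

lemma dZ_Suc: "dZ h v (Suc k) = exp (v k) * (h + dZ h v k * exp (- v (Suc k)))"
  by (simp add: dZ_def dA_Suc exp_add exp_minus field_simps)

text \<open>This is the shear. With \<open>ln (dZ h v k)\<close> already serving as a coordinate in
  place of \<open>v (k - 1)\<close>, the second summand does not involve \<open>v k\<close>, so the
  new coordinate is a translate of \<open>v k\<close>.\<close>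

lemma ln_dZ_Suc:
  assumes "h > 0"
  shows "ln (dZ h v (Suc k)) = v k + ln (h + dZ h v k * exp (- v (Suc k)))"
proof -
  have "h + dZ h v k * exp (- v (Suc k)) > 0"
    using assms dZ_pos[OF assms, of v k] by (intro add_pos_pos) auto
  then show ?thesis
    by (simp add: dZ_Suc ln_mult)
qed

text \<open>Writes the energy through the quantities \<open>dZ\<close>, which the transformation fixes, and an even
  function of the last position, whose sign it flips.\<close>

lemma dE_eq:
  assumes h: "h > 0"
  shows "dE v k =
    (\<Sum>j<k. (dZ h v (Suc j) / dZ h v j + dZ h v j / dZ h v (Suc j)
       + h\<^sup>2 / (dZ h v j * dZ h v (Suc j))) / 2) + h * cosh (v k) / dZ h v k"
proof (induction k)
  case 0
  then show ?case using h by (simp add: dE_def dZ_0)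
next
  case (Suc k)
  define z where "z = dZ h v k"
  define p where "p = exp (v k)"
  define q where "q = exp (v (Suc k))"
  have pos: "z > 0" "p > 0" "q > 0" "q * h + z > 0"
    using dZ_pos[OF h, of v k] h by (auto simp: z_def p_def q_def intro!: add_pos_pos)
  have z': "dZ h v (Suc k) = p * (q * h + z) / q"
    using pos by (simp add: dZ_Suc z_def p_def q_def exp_minus field_simps)
  have cosh: "cosh (v (Suc k) - v k) = (q / p + p / q) / 2"
      "cosh (v k) = (p + 1 / p) / 2" "cosh (v (Suc k)) = (q + 1 / q) / 2"
    by (simp_all add: cosh_field_def exp_diff p_def q_def exp_minus field_simps)
  \<comment> \<open>Telescoping: the new increment plus the old boundary term equals the new summand
    plus the new boundary term. With the exponentials named, this is a rational identity.\<close>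
  have step: "(q / p + p / q) / 2 + h * ((p + 1 / p) / 2) / z =
      (p * (q * h + z) / q / z + z / (p * (q * h + z) / q)
        + h\<^sup>2 / (z * (p * (q * h + z) / q))) / 2 + h * ((q + 1 / q) / 2) / (p * (q * h + z) / q)"
    using pos by (simp add: divide_simps) (simp add: power2_eq_square algebra_simps)
  have "dE v (Suc k) = dE v k + (q / p + p / q) / 2"
    by (simp add: dE_def cosh)
  then show ?case
    using step by (simp only: Suc sum.lessThan_Suc z' cosh z_def[symmetric])
qed

section \<open>Effect of the discrete transformation on \<open>dA\<close>, \<open>dZ\<close> and
  \<open>dE\<close>\<close>

context
  fixes n :: nat and h :: real
  assumes h: "h > 0" and n: "n > 0"
begin

text \<open>The argument of the logarithm is a convex combination of \<open>1\<close> and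
  \<open>exp (2 * v (n - 1))\<close>, with weight the ratio of \<open>dA\<close> at \<open>k\<close>
  to its final value.\<close>

lemma dT_arg_pos:
  assumes "k < n"
  shows "1 + dA h v k * dc n h v > 0"
proof -
  define r where "r = dA h v k / dA h v (n - 1)"
  have r: "0 < r" "r \<le> 1"
    using dA_pos[OF h, of v] dA_mono[OF h, of k "n - 1" v] assms by (auto simp: r_def)
  have "0 < (1 - r) + r * exp (2 * v (n - 1))"
    using r by (intro add_nonneg_pos) auto
  then show ?thesis by (simp add: r_def dc_def algebra_simps diff_divide_distrib)
qed

lemma exp_dT:
  assumes "k < n"
  shows "exp (dT n h v k) =
    exp (v k) / (1 + dA h v k * dc n h v)"
  using assms dT_arg_pos[OF assms, of v] by (simp add: dT_def exp_diff)

lemma dT_last: "dT n h v (n - 1) = - v (n - 1)"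
  using n dA_pos[OF h, of v "n - 1"] by (simp add: dT_def dc_def)

text \<open>Each cell product of neighbouring exponentials acquires the denominator
  \<open>(1 + a * c) * (1 + b * c)\<close>, where \<open>a\<close> and \<open>b\<close> are
  consecutive values of \<open>dA\<close>. Since the untransformed cell contributes
  \<open>b - a\<close>, the quotient is exactly the increment of \<open>x / (1 + c * x)\<close> from
  \<open>a\<close> to \<open>b\<close>.\<close>

lemma dA_dT:
  assumes "k < n"
  shows "dA h (dT n h v) k =
    dA h v k / (1 + dA h v k * dc n h v)"
  using assms
proof (induction k)
  case 0
  then show ?case by (simp add: dA_0 exp_dT)
next
  case (Suc k)
  define c where "c = dc n h v"
  define a where "a = dA h v k"
  define b where "b = dA h v (Suc k)"
  have pos: "1 + a * c > 0" "1 + b * c > 0"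
    using dT_arg_pos[of k v] dT_arg_pos[of "Suc k" v] Suc.prems by (auto simp: c_def a_def b_def)
  have "dA h (dT n h v) (Suc k) = a / (1 + a * c) + h * (exp (v k) / (1 + a * c) * (exp (v (Suc k)) / (1 + b * c)))"
    using Suc by (simp add: dA_Suc[of h "dT n h v"] exp_add exp_dT a_def[symmetric] b_def[symmetric] c_def[symmetric] del: One_nat_def)
  also have "h * (exp (v k) / (1 + a * c) * (exp (v (Suc k)) / (1 + b * c))) =
      (b - a) / ((1 + a * c) * (1 + b * c))"
    by (simp add: a_def b_def dA_Suc exp_add)
  also have "a / (1 + a * c) + (b - a) / ((1 + a * c) * (1 + b * c)) = b / (1 + b * c)"
    using pos by (simp add: divide_simps) (simp add: algebra_simps)
  finally show ?case by (simp add: c_def b_def)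
qed

text \<open>The factor lost by \<open>dA\<close> is gained by \<open>exp (- v k)\<close>.\<close>

lemma dZ_dT:
  assumes "k < n"
  shows "dZ h (dT n h v) k = dZ h v k"
proof -
  define c where "c = 1 + dA h v k * dc n h v"
  have "c > 0"
    using dT_arg_pos[OF assms] by (simp add: c_def)
  then show ?thesis
    using assms by (simp add: dZ_def exp_minus exp_dT dA_dT divide_inverse flip: c_def)
qed

text \<open>By \<open>dE_eq\<close> the energy is a function of the fixed \<open>dZ\<close> and of
  the hyperbolic cosine of the last position, which is even.\<close>

lemma dE_dT: "dE (dT n h v) (n - 1) = dE v (n - 1)"
proof -
  have "dZ h (dT n h v) j = dZ h v j" if "j \<le> n - 1" for j
    using dZ_dT that n by simp
  then show ?thesis
    by (simp add: dE_eq[OF h] dT_last del: One_nat_def)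
qed

end

section \<open>Invariance of Lebesgue measure\<close>

text \<open>Fubini with coordinate \<open>k\<close> innermost: for frozen other coordinates
  \<open>g\<close> is constant, and the map is a translation or reflection of the line. Taking
  \<open>c = 1\<close> gives shears, \<open>c = - 1\<close> the sign flip.\<close>

lemma distr_PiM_lborel_affine:
  fixes g :: "('i \<Rightarrow> real) \<Rightarrow> real"
  assumes I: "finite I" "k \<in> I"
    and g: "g \<in> borel_measurable (PiM I (\<lambda>_. lborel))"
    and g_upd: "\<And>w x. g (w(k := x)) = g w"
    and c: "\<bar>c\<bar> = 1"
  shows "distr (PiM I (\<lambda>_. lborel)) (PiM I (\<lambda>_. lborel)) (\<lambda>w. w(k := c * w k + g w)) =
    PiM I (\<lambda>_. lborel)"
    (is "distr ?L _ ?f = _")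
proof (rule measure_eqI)
  interpret product_sigma_finite "\<lambda>_::'i. lborel :: real measure" ..
  have f: "?f \<in> ?L \<rightarrow>\<^sub>M ?L"
    using I g by (intro measurable_fun_upd[where J=I]) auto
  have I_eq: "insert k (I - {k}) = I"
    using I by auto
  have insert: "(\<integral>\<^sup>+w. F w \<partial>?L) =
      (\<integral>\<^sup>+w. (\<integral>\<^sup>+y. F (w(k := y)) \<partial>lborel) \<partial>PiM (I - {k}) (\<lambda>_. lborel))"
    if "F \<in> borel_measurable ?L" for F :: "('i \<Rightarrow> real) \<Rightarrow> ennreal"
    using product_nn_integral_insert[of "I - {k}" k F] I that unfolding I_eq by auto
  fix A assume "A \<in> sets (distr ?L ?L ?f)"
  then have A: "A \<in> sets ?L" by simp
  have "emeasure (distr ?L ?L ?f) A = (\<integral>\<^sup>+w. indicator A (?f w) \<partial>?L)"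
    using A f by (subst nn_integral_indicator[symmetric], simp, subst nn_integral_distr, auto)
  also have "\<dots> = (\<integral>\<^sup>+w. (\<integral>\<^sup>+y. indicator A (w(k := g w + c * y)) \<partial>lborel)
      \<partial>PiM (I - {k}) (\<lambda>_. lborel))"
    using A f by (subst insert) (auto simp: g_upd add.commute)
  also have "\<dots> = (\<integral>\<^sup>+w. (\<integral>\<^sup>+y. indicator A (w(k := y)) \<partial>lborel)
      \<partial>PiM (I - {k}) (\<lambda>_. lborel))"
  proof (rule nn_integral_cong)
    fix w assume w: "w \<in> space (PiM (I - {k}) (\<lambda>_. lborel :: real measure))"
    have "(\<lambda>y. w(k := y)) \<in> lborel \<rightarrow>\<^sub>M ?L"
      using w I by (intro measurable_fun_upd[where J="I - {k}"]) auto
    then have "(\<lambda>y. indicator A (w(k := y)) :: ennreal) \<in> borel_measurable borel"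
      using A by (simp add: borel_measurable_indicator')
    from nn_integral_real_affine[OF this, of c "g w"] c
    show "(\<integral>\<^sup>+y. indicator A (w(k := g w + c * y)) \<partial>lborel) =
        (\<integral>\<^sup>+y. indicator A (w(k := y)) \<partial>lborel)"
      by (auto simp: abs_if split: if_splits)
  qed
  also have "\<dots> = emeasure ?L A"
    using A by (subst insert[symmetric]) auto
  finally show "emeasure (distr ?L ?L ?f) A = emeasure ?L A" .
qed simp

section \<open>Changes of variables made of one-coordinate shears\<close>

abbreviation leb :: "nat \<Rightarrow> (nat \<Rightarrow> real) measure" where
  "leb n \<equiv> PiM {..<n} (\<lambda>_. lborel)"

text \<open>The stages of a change of variables. Consecutive stages differ in one coordinate only,
  so each step is covered by one-dimensional translation invariance.\<close>

definition mix :: "nat \<Rightarrow> nat \<Rightarrow> ((nat \<Rightarrow> real) \<Rightarrow> nat \<Rightarrow> real) \<Rightarrow> (nat \<Rightarrow> real) \<Rightarrow> nat \<Rightarrow> real" where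
  "mix n k y v = (\<lambda>j\<in>{..<n}. if j < k then y v j else v j)"

lemma leb_component [measurable]: "k < n \<Longrightarrow> (\<lambda>v. v k) \<in> borel_measurable (leb n)"
  using measurable_component_singleton[of k "{..<n}" "\<lambda>_. lborel"] by simp

lemma prev_measurable: "i < n \<Longrightarrow> (\<lambda>v. prev v i) \<in> borel_measurable (leb n)"
  by (cases i) (auto intro: leb_component)

text \<open>The map \<open>y\<close> is built one coordinate at a time: when coordinate \<open>k\<close> is translated, the
  coordinates below \<open>k\<close> already have their new values.\<close>

locale triangular_shear =
  fixes n m :: nat and y :: "(nat \<Rightarrow> real) \<Rightarrow> nat \<Rightarrow> real" and g :: "nat \<Rightarrow> (nat \<Rightarrow> real) \<Rightarrow> real"
  assumes m: "m \<le> n"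
    and y: "\<And>k v. k < m \<Longrightarrow> y v k = v k + g k (mix n k y v)"
    and g: "\<And>k. k < m \<Longrightarrow> g k \<in> borel_measurable (leb n)"
    and g_upd: "\<And>k w x. k < m \<Longrightarrow> g k (w(k := x)) = g k w"
begin

lemma mix_Suc:
  assumes "k < m"
  shows "mix n (Suc k) y v = (mix n k y v)(k := 1 * mix n k y v k + g k (mix n k y v))"
proof -
  have k: "mix n k y v k = v k"
    using assms m by (simp add: mix_def)
  show ?thesis
  proof
    fix j
    show "mix n (Suc k) y v j = ((mix n k y v)(k := 1 * mix n k y v k + g k (mix n k y v))) j"
    proof (cases "j = k")
      case True
      have "mix n (Suc k) y v k = y v k"
        using assms m by (simp add: mix_def)
      also have "\<dots> = 1 * mix n k y v k + g k (mix n k y v)"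
        unfolding k using y[OF assms] by simp
      finally show ?thesis using True by simp
    qed (simp add: mix_def)
  qed
qed

lemma shear_measurable:
  assumes "k < m"
  shows "(\<lambda>w. w(k := c * w k + g k w)) \<in> leb n \<rightarrow>\<^sub>M leb n"
  using assms m g by (intro measurable_fun_upd[where J="{..<n}"]) auto

lemma unshear_measurable:
  assumes "k < m"
  shows "(\<lambda>w. w(k := w k - g k w)) \<in> leb n \<rightarrow>\<^sub>M leb n"
  using assms m g by (intro measurable_fun_upd[where J="{..<n}"]) auto

lemma mix_0: "v \<in> space (leb n) \<Longrightarrow> mix n 0 y v = v"
  by (auto simp: mix_def space_PiM PiE_def extensional_def fun_eq_iff)

lemma mix_measurable:
  assumes "k \<le> m"
  shows "mix n k y \<in> leb n \<rightarrow>\<^sub>M leb n"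
  using assms
proof (induction k)
  case 0
  then show ?case
    by (simp add: mix_0 cong: measurable_cong)
next
  case (Suc k)
  have eq: "mix n (Suc k) y = (\<lambda>w. w(k := 1 * w k + g k w)) \<circ> mix n k y"
    using Suc.prems by (simp add: fun_eq_iff[of "mix n (Suc k) y"] mix_Suc)
  show ?case
    unfolding eq by (rule measurable_comp[OF Suc.IH shear_measurable]) (use Suc.prems in simp_all)
qed

lemma distr_mix:
  assumes "k \<le> m"
  shows "distr (leb n) (leb n) (mix n k y) = leb n"
  using assms
proof (induction k)
  case 0
  have "distr (leb n) (leb n) (mix n 0 y) = distr (leb n) (leb n) (\<lambda>v. v)"
    by (rule distr_cong) (auto simp: mix_0)
  then show ?case by simp
next
  case (Suc k)
  have "mix n (Suc k) y = (\<lambda>w. w(k := 1 * w k + g k w)) \<circ> mix n k y"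
    using Suc.prems by (simp add: fun_eq_iff[of "mix n (Suc k) y"] mix_Suc)
  then have "distr (leb n) (leb n) (mix n (Suc k) y) =
      distr (distr (leb n) (leb n) (mix n k y)) (leb n) (\<lambda>w. w(k := 1 * w k + g k w))"
    using Suc.prems shear_measurable[of k 1] mix_measurable[of k] by (simp add: distr_distr)
  also have "\<dots> = leb n"
    using Suc m g g_upd distr_PiM_lborel_affine[of "{..<n}" k "g k" 1] by simp
  finally show ?case .
qed

text \<open>Each shear is undone by subtracting \<open>g k\<close>, whose value is unaffected by
  changing coordinate \<open>k\<close>. This allows the change of variables to be cancelled from an
  identity between image measures.\<close>

lemma distr_mix_inject:
  assumes "k \<le> m" and sets: "sets \<mu> = sets (leb n)" "sets \<nu> = sets (leb n)"
    and eq: "distr \<mu> (leb n) (mix n k y) = distr \<nu> (leb n) (mix n k y)"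
  shows "\<mu> = \<nu>"
  using assms(1) eq
proof (induction k)
  case 0
  have "distr \<rho> (leb n) (mix n 0 y) = \<rho>" if "sets \<rho> = sets (leb n)" for \<rho>
  proof -
    have "distr \<rho> (leb n) (mix n 0 y) = distr \<rho> \<rho> (\<lambda>v. v)"
      using that sets_eq_imp_space_eq[OF that] by (intro distr_cong) (auto simp: mix_0)
    then show ?thesis by simp
  qed
  then show ?case using 0 sets by metis
next
  case (Suc k)
  let ?R = "\<lambda>w. w(k := w k - g k w)"
  have undo: "mix n k y = ?R \<circ> mix n (Suc k) y"
    using Suc.prems by (simp add: fun_eq_iff[of "mix n k y"] mix_Suc g_upd)
  have "distr \<rho> (leb n) (mix n k y) = distr (distr \<rho> (leb n) (mix n (Suc k) y)) (leb n) ?R"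
    if "sets \<rho> = sets (leb n)" for \<rho>
  proof -
    have "mix n (Suc k) y \<in> \<rho> \<rightarrow>\<^sub>M leb n"
      using mix_measurable[OF Suc.prems(1)] measurable_cong_sets[OF that refl] by blast
    then show ?thesis
      using Suc.prems unshear_measurable[of k] undo by (simp add: distr_distr)
  qed
  then show ?case
    using Suc sets by simp
qed

end

section \<open>Measurability of the discrete functionals, and Lebesgue measure under
  \<open>dT\<close>\<close>

lemma dA_measurable [measurable]:
  assumes "k < n"
  shows "(\<lambda>v. dA h v k) \<in> borel_measurable (leb n)"
proof -
  have "(\<lambda>v. exp (v j + prev v j)) \<in> borel_measurable (leb n)" if "j \<le> k" for j
    using that assms by (cases j) simp_all
  then show ?thesis
    unfolding dA_def by (intro borel_measurable_times borel_measurable_sum) auto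
qed

lemma dE_measurable [measurable]:
  assumes "k < n"
  shows "(\<lambda>v. dE v k) \<in> borel_measurable (leb n)"
proof -
  have "(\<lambda>v. cosh (v j - prev v j)) \<in> borel_measurable (leb n)" if "j \<le> k" for j
    using that assms unfolding cosh_field_def by (cases j) simp_all
  then show ?thesis
    unfolding dE_def by (intro borel_measurable_sum) auto
qed

lemma dT_measurable: "dT n h \<in> leb n \<rightarrow>\<^sub>M leb n"
proof (cases "n = 0")
  case False
  then have [measurable]: "(\<lambda>v. v (n - 1)) \<in> borel_measurable (leb n)"
      "(\<lambda>v. dA h v (n - 1)) \<in> borel_measurable (leb n)"
    by (simp_all add: dA_measurable leb_component)
  have "(\<lambda>v. v k - ln (1 + dA h v k * dc n h v)) \<in> borel_measurable (leb n)" if "k < n" for k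
  proof -
    have [measurable]: "(\<lambda>v. v k) \<in> borel_measurable (leb n)"
        "(\<lambda>v. dA h v k) \<in> borel_measurable (leb n)"
      using that by (simp_all add: dA_measurable leb_component)
    show ?thesis
      unfolding dc_def by measurable
  qed
  then show ?thesis
    unfolding dT_def by (intro measurable_restrict) auto
next
  case True
  then show ?thesis
    unfolding dT_def by (intro measurable_restrict) auto
qed

lemma distr_dT:
  assumes h: "h > 0" and n: "n > 0"
  shows "distr (leb n) (leb n) (dT n h) = leb n"
proof -
  \<comment> \<open>In the coordinates \<open>ln dZ\<close> and the last position, the transformation is a reflection of the
    last coordinate, and by \<open>ln_dZ_Suc\<close> these coordinates arise by successive shears.\<close>
  define y where "y = (\<lambda>v j. ln (dZ h v (Suc j)))"
  \<comment> \<open>In mixed coordinates slot \<open>k - 1\<close> already holds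
    \<open>ln (dZ h v k)\<close>; for \<open>k = 0\<close> the starting value is \<open>h\<close> by
    \<open>dZ_0\<close>.\<close>
  define g where "g = (\<lambda>k w. ln (h + (if k = 0 then h else exp (w (k - 1))) * exp (- w (Suc k))))"
  \<comment> \<open>Only \<open>n - 1\<close> stages are performed, so the last coordinate remains
    the last position.\<close>
  define S where "S = mix n (n - 1) y"
  define N where "N = (\<lambda>w::nat \<Rightarrow> real. w(n - 1 := - 1 * w (n - 1) + 0))"
  have y: "y v k = v k + g k (mix n k y v)" if "k < n - 1" for k v
  proof -
    have "(if k = 0 then h else exp (mix n k y v (k - 1))) = dZ h v k"
      using that dZ_pos[OF h, of v k] by (cases k) (auto simp: mix_def y_def dZ_0)
    moreover have "mix n k y v (Suc k) = v (Suc k)"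
      using that by (auto simp: mix_def)
    ultimately have "g k (mix n k y v) = ln (h + dZ h v k * exp (- v (Suc k)))"
      by (simp only: g_def)
    then show ?thesis
      using ln_dZ_Suc[OF h, of v k] by (simp add: y_def)
  qed
  have g: "g k \<in> borel_measurable (leb n)" if "k < n - 1" for k
  proof -
    have "(\<lambda>w. w (k - 1)) \<in> borel_measurable (leb n)" "(\<lambda>w. w (Suc k)) \<in> borel_measurable (leb n)"
      using that by (auto intro!: leb_component)
    then show ?thesis
      unfolding g_def by measurable
  qed
  have g_upd: "g k (w(k := x)) = g k w" for k w x
    by (cases k) (simp_all add: g_def)
  interpret S: triangular_shear n "n - 1" y g
    by unfold_locales (simp, rule y, simp, rule g, simp, rule g_upd)
  have S: "S \<in> leb n \<rightarrow>\<^sub>M leb n" "distr (leb n) (leb n) S = leb n"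
    unfolding S_def by (rule S.mix_measurable S.distr_mix, simp)+
  have N: "N \<in> leb n \<rightarrow>\<^sub>M leb n"
    unfolding N_def using n by (intro measurable_fun_upd[where J="{..<n}"]) auto
  have N': "distr (leb n) (leb n) N = leb n"
    using n distr_PiM_lborel_affine[of "{..<n}" "n - 1" "\<lambda>_. 0" "- 1"] by (simp add: N_def)
  \<comment> \<open>\<open>S\<close> conjugates \<open>dT\<close> to the reflection
    \<open>N\<close>: the coordinates \<open>ln dZ\<close> are fixed and the last position changes
    sign.\<close>
  have comm: "S (dT n h v) = N (S v)" for v
  proof
    fix j
    show "S (dT n h v) j = N (S v) j"
      using n dZ_dT[OF h n, of "Suc j" v] dT_last[OF h n, of v]
      by (cases "j < n - 1"; cases "j = n - 1") (auto simp: S_def N_def mix_def y_def)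
  qed
  \<comment> \<open>Both sides are images under \<open>S\<close>, and \<open>S\<close> can then be
    cancelled by injectivity.\<close>
  have "distr (distr (leb n) (leb n) (dT n h)) (leb n) S = distr (distr (leb n) (leb n) S) (leb n) N"
    by (simp add: distr_distr S(1) N dT_measurable o_def comm)
  also have "\<dots> = distr (leb n) (leb n) S"
    by (simp add: S N')
  finally show ?thesis
    unfolding S_def by (rule S.distr_mix_inject[of "n - 1", rotated 3]) auto
qed

section \<open>Densities of product laws and of random walks\<close>

text \<open>It suffices to compare on boxes, whose indicators factorise, so that Fubini splits the
  integral.\<close>

lemma density_PiM_lborel:
  fixes p :: "real \<Rightarrow> ennreal"
  assumes I: "finite I" and p [measurable]: "p \<in> borel_measurable borel"
    and prob: "prob_space (density lborel p)"
  shows "PiM I (\<lambda>_. density lborel p) = density (PiM I (\<lambda>_. lborel)) (\<lambda>x. \<Prod>i\<in>I. p (x i))"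
proof -
  interpret L: product_sigma_finite "\<lambda>_. lborel :: real measure" ..
  interpret P: product_prob_space "\<lambda>_. density lborel p"
    using prob by (simp add: product_prob_spaceI)
  show ?thesis
  proof (rule P.PiM_eqI[symmetric, OF I])
    fix A assume "\<And>i. i \<in> I \<Longrightarrow> A i \<in> sets (density lborel p)"
    then have A [measurable]: "\<And>i. i \<in> I \<Longrightarrow> A i \<in> sets borel" by simp
    have "PiE I A \<in> sets (PiM I (\<lambda>_. lborel))"
      using A I by (intro sets_PiM_I_finite) auto
    then have "emeasure (density (PiM I (\<lambda>_. lborel)) (\<lambda>x. \<Prod>i\<in>I. p (x i))) (PiE I A) =
        (\<integral>\<^sup>+x. (\<Prod>i\<in>I. p (x i)) * indicator (PiE I A) x \<partial>PiM I (\<lambda>_. lborel))"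
      using I by (subst emeasure_density) (auto intro!: borel_measurable_prod_ennreal
        measurable_compose[OF _ p] measurable_component_singleton[of _ I "\<lambda>_. lborel", simplified])
    also have "\<dots> = (\<integral>\<^sup>+x. (\<Prod>i\<in>I. p (x i) * indicator (A i) (x i)) \<partial>PiM I (\<lambda>_. lborel))"
      using I by (intro nn_integral_cong)
        (auto simp: prod.distrib space_PiM PiE_iff indicator_def prod_zero_iff split: if_splits)
    also have "\<dots> = (\<Prod>i\<in>I. \<integral>\<^sup>+x. p x * indicator (A i) x \<partial>lborel)"
      using I A by (intro L.product_nn_integral_prod) auto
    also have "\<dots> = (\<Prod>i\<in>I. emeasure (density lborel p) (A i))"
      using A by (intro prod.cong) (auto simp: emeasure_density)
    finally show "emeasure (density (PiM I (\<lambda>_. lborel)) (\<lambda>x. \<Prod>i\<in>I. p (x i))) (PiE I A) =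
      (\<Prod>i\<in>I. emeasure (density lborel p) (A i))" .
  qed (simp cong: sets_PiM_cong)
qed

text \<open>Partial summation is a triangular shear: coordinate \<open>k\<close> is translated by
  the new value of coordinate \<open>k - 1\<close>. It therefore preserves Lebesgue measure, and
  only the density has to be rewritten in the increments.\<close>

lemma distr_partial_sums:
  fixes p :: "real \<Rightarrow> ennreal"
  assumes p [measurable]: "p \<in> borel_measurable borel"
  shows "distr (density (leb n) (\<lambda>x. \<Prod>i<n. p (x i))) (leb n) (\<lambda>x. \<lambda>i\<in>{..<n}. \<Sum>j\<le>i. x j) =
    density (leb n) (\<lambda>v. \<Prod>i<n. p (v i - prev v i))"
proof -
  define y where "y = (\<lambda>(v::nat \<Rightarrow> real) i. \<Sum>j\<le>i. v j)"
  define g where "g = (\<lambda>k w. prev w k)"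
  have y: "y v k = v k + g k (mix n k y v)" if "k < n" for k v
    using that by (cases k) (auto simp: y_def g_def mix_def)
  have g: "g k \<in> borel_measurable (leb n)" if "k < n" for k
    using that by (simp add: g_def prev_measurable)
  have g_upd: "g k (w(k := x)) = g k w" for k w x
    by (cases k) (simp_all add: g_def)
  have P: "mix n n y = (\<lambda>x. \<lambda>i\<in>{..<n}. \<Sum>j\<le>i. x j)"
    by (auto simp: mix_def y_def fun_eq_iff)
  interpret P: triangular_shear n n y g
    by unfold_locales (simp, rule y, simp, rule g, simp, rule g_upd)
  have meas: "(\<lambda>v. \<Prod>i<n. p (v i - prev v i)) \<in> borel_measurable (leb n)"
    using prev_measurable by (intro borel_measurable_prod_ennreal measurable_compose[OF _ p]) auto
  have "(\<Prod>i<n. p (x i)) = (\<Prod>i<n. p (mix n n y x i - prev (mix n n y x) i))" for x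
  proof (rule prod.cong)
    fix i assume "i \<in> {..<n}"
    then show "p (x i) = p (mix n n y x i - prev (mix n n y x) i)"
      by (cases i) (auto simp: P)
  qed simp
  then have "distr (density (leb n) (\<lambda>x. \<Prod>i<n. p (x i))) (leb n) (mix n n y) =
      density (distr (leb n) (leb n) (mix n n y)) (\<lambda>v. \<Prod>i<n. p (v i - prev v i))"
    using meas P.mix_measurable[of n] by (simp add: density_distr)
  also have "distr (leb n) (leb n) (mix n n y) = leb n"
    using P.distr_mix[of n] by simp
  finally show ?thesis
    by (simp only: P)
qed

section \<open>Comparison of the Gaussian and the hyperbolic cosine walk\<close>

text \<open>Density, relative to the Gaussian increment of variance \<open>h\<close>, of an increment with law
  proportional to \<open>exp (- cosh x / h)\<close>, for which the discrete transformation is exactly measure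
  preserving.\<close>

definition cosh_ratio :: "real \<Rightarrow> real \<Rightarrow> real" where
  "cosh_ratio h x = exp (- (cosh x - 1 - x\<^sup>2 / 2) / h)"

definition cosh_const :: "real \<Rightarrow> real" where
  "cosh_const h = (\<integral>x. normal_density 0 (sqrt h) x * cosh_ratio h x \<partial>lborel)"

definition cosh_dens :: "nat \<Rightarrow> real \<Rightarrow> (nat \<Rightarrow> real) \<Rightarrow> real" where
  "cosh_dens n h v = (\<Prod>i<n. cosh_ratio h (v i - prev v i) / cosh_const h)"

text \<open>Expansions of \<open>exp x\<close> and \<open>exp (- x)\<close> to fourth order: the odd
  terms cancel in the mean, leaving \<open>(exp s + exp u) / 48 * x ^ 4\<close>. On the unit
  interval the coefficient is at most \<open>6 / 48\<close>.\<close>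

lemma cosh_remainder:
  fixes x :: real
  shows "0 \<le> cosh x - 1 - x\<^sup>2 / 2" and "\<bar>x\<bar> \<le> 1 \<Longrightarrow> cosh x - 1 - x\<^sup>2 / 2 \<le> x ^ 4"
proof -
  obtain s where s: "\<bar>s\<bar> \<le> \<bar>x\<bar>" "exp x = (\<Sum>m<4. x ^ m / fact m) + exp s / fact 4 * x ^ 4"
    using Maclaurin_exp_le[of x 4] by blast
  obtain u where u: "\<bar>u\<bar> \<le> \<bar>- x\<bar>" "exp (- x) = (\<Sum>m<4. (- x) ^ m / fact m) + exp u / fact 4 * (- x) ^ 4"
    using Maclaurin_exp_le[of "- x" 4] by blast
  have "cosh x = (exp x + exp (- x)) / 2"
    by (simp add: cosh_field_def)
  also have "\<dots> = 1 + x\<^sup>2 / 2 + (exp s + exp u) / 48 * x ^ 4"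
    unfolding s(2) u(2)
    by (simp add: eval_nat_numeral lessThan_Suc algebra_simps)
  finally have eq: "cosh x - 1 - x\<^sup>2 / 2 = (exp s + exp u) / 48 * x ^ 4"
    by simp
  show "0 \<le> cosh x - 1 - x\<^sup>2 / 2"
    unfolding eq by (intro mult_nonneg_nonneg divide_nonneg_nonneg add_nonneg_nonneg) auto
  assume "\<bar>x\<bar> \<le> 1"
  then have "exp s \<le> 3" "exp u \<le> 3"
    using s(1) u(1) by (auto intro!: order_trans[OF _ exp_le])
  then have "exp s + exp u \<le> 3 + 3"
    by (rule add_mono)
  then have "(exp s + exp u) / 48 \<le> 1"
    by simp
  then show "cosh x - 1 - x\<^sup>2 / 2 \<le> x ^ 4"
    unfolding eq using mult_right_mono[of "(exp s + exp u) / 48" 1 "x ^ 4"] by simp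
qed

text \<open>For \<open>\<bar>x\<bar> \<le> 1\<close> the last bound is
  \<open>1 - exp (- y) \<le> y\<close> with the fourth-order remainder; otherwise
  \<open>x ^ 4 / h\<close> already exceeds 1 because \<open>h \<le> 1\<close>.\<close>

lemma cosh_ratio_bounds:
  assumes h: "0 < h" "h \<le> 1"
  shows "0 < cosh_ratio h x" "cosh_ratio h x \<le> 1" "1 - cosh_ratio h x \<le> x ^ 4 / h"
proof -
  show "0 < cosh_ratio h x"
    by (simp add: cosh_ratio_def)
  show "cosh_ratio h x \<le> 1"
    using cosh_remainder(1)[of x] h by (simp add: cosh_ratio_def divide_nonpos_pos)
  show "1 - cosh_ratio h x \<le> x ^ 4 / h"
  proof (cases "\<bar>x\<bar> \<le> 1")
    case True
    have "1 + (- (cosh x - 1 - x\<^sup>2 / 2) / h) \<le> cosh_ratio h x"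
      unfolding cosh_ratio_def by (rule exp_ge_add_one_self)
    moreover have "(cosh x - 1 - x\<^sup>2 / 2) / h \<le> x ^ 4 / h"
      using cosh_remainder(2)[OF True] h by (intro divide_right_mono) auto
    ultimately show ?thesis
      unfolding minus_divide_left[symmetric] by linarith
  next
    case False
    then have "1 \<le> \<bar>x\<bar> ^ 4"
      by (intro one_le_power) auto
    then have "h \<le> x ^ 4"
      using h by simp
    then have "1 \<le> x ^ 4 / h"
      using h by simp
    then show ?thesis
      using \<open>0 < cosh_ratio h x\<close> by linarith
  qed
qed

lemma cosh_ratio_measurable [measurable]: "cosh_ratio h \<in> borel_measurable borel"
  unfolding cosh_ratio_def cosh_field_def by measurable

text \<open>The Gaussian fourth moment \<open>3 * h\<^sup>2\<close> gives
  \<open>1 - cosh_const h \<le> 3 * h\<close>, hence the threshold \<open>1 / 6\<close>. The eighth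
  moment \<open>105 * h ^ 4\<close> gives a mean square deviation from 1 of at most
  \<open>105 * h\<^sup>2\<close>; dividing by the squared constant, at least \<open>1 / 4\<close>,
  produces \<open>420\<close>.\<close>

lemma cosh_ratio_moments:
  assumes h: "0 < h" "h \<le> 1 / 6"
  shows "1 / 2 \<le> cosh_const h" "cosh_const h \<le> 1"
    and "(\<integral>x. normal_density 0 (sqrt h) x * (cosh_ratio h x / cosh_const h)\<^sup>2 \<partial>lborel) \<le> 1 + 420 * h\<^sup>2"
proof -
  let ?p = "normal_density 0 (sqrt h)"
  define N where "N = density lborel (\<lambda>x. ennreal (?p x))"
  interpret N: prob_space N
    unfolding N_def using h by (intro prob_space_normal_density) simp
  have int_N: "(\<integral>x. f x \<partial>N) = (\<integral>x. ?p x * f x \<partial>lborel)"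
    if "f \<in> borel_measurable borel" for f :: "real \<Rightarrow> real"
    unfolding N_def using that by (subst integral_density) auto
  have ible_N: "integrable N f \<longleftrightarrow> integrable lborel (\<lambda>x. ?p x * f x)"
    if "f \<in> borel_measurable borel" for f :: "real \<Rightarrow> real"
    unfolding N_def using that by (subst integrable_density) auto
  have meas_N: "f \<in> borel_measurable N" if "f \<in> borel_measurable borel" for f :: "real \<Rightarrow> real"
    using that by (simp add: N_def)
  have moment: "has_bochner_integral lborel (\<lambda>x. ?p x * x ^ (2 * k)) (fact (2 * k) / ((2 / h) ^ k * fact k))" for k
    using normal_moment_even[of "sqrt h" 0 k] h(1)
    by (simp only: diff_zero real_sqrt_pow2[OF less_imp_le[OF h(1)]] real_sqrt_gt_0_iff)
  have m4: "integrable N (\<lambda>x. x ^ 4)" "(\<integral>x. x ^ 4 \<partial>N) = 3 * h\<^sup>2"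
    using moment[of 2] h by (auto simp: ible_N int_N has_bochner_integral_iff fact_numeral field_simps power2_eq_square)
  have m8: "integrable N (\<lambda>x. x ^ 8)" "(\<integral>x. x ^ 8 \<partial>N) = 105 * h ^ 4"
    using moment[of 4] h by (auto simp: ible_N int_N has_bochner_integral_iff fact_numeral field_simps eval_nat_numeral)
  note b = cosh_ratio_bounds[of h]
  have h1: "0 < h" "h \<le> 1" using h by auto
  have int_r: "integrable N (cosh_ratio h)"
    using b(1,2)[OF h1] by (intro N.integrable_const_bound[where B=1] meas_N AE_I2)
        (auto simp: less_imp_le)
  have int_r2: "integrable N (\<lambda>x. (cosh_ratio h x)\<^sup>2)"
    using b(1,2)[OF h1] by (intro N.integrable_const_bound[where B=1] meas_N AE_I2)
        (auto simp: less_imp_le power_le_one)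
  have c: "cosh_const h = (\<integral>x. cosh_ratio h x \<partial>N)"
    by (simp add: cosh_const_def int_N)
  have "(\<integral>x. 1 - cosh_ratio h x \<partial>N) \<le> (\<integral>x. x ^ 4 / h \<partial>N)"
    using b(3)[OF h1] int_r m4(1) by (intro integral_mono) auto
  also have "\<dots> = 3 * h"
    using h by (simp add: m4(2) power2_eq_square)
  finally have "1 - cosh_const h \<le> 3 * h"
    using int_r by (simp add: c N.prob_space)
  then show c1: "1 / 2 \<le> cosh_const h"
    using h by simp
  have "(\<integral>x. cosh_ratio h x \<partial>N) \<le> (\<integral>x. 1 \<partial>N)"
    using b(2)[OF h1] int_r by (intro integral_mono) auto
  then show "cosh_const h \<le> 1"
    by (simp add: c N.prob_space)
  have "(\<integral>x. (1 - cosh_ratio h x)\<^sup>2 \<partial>N) \<le> (\<integral>x. x ^ 8 / h\<^sup>2 \<partial>N)"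
  proof (intro integral_mono)
    show "integrable N (\<lambda>x. (1 - cosh_ratio h x)\<^sup>2)"
      using int_r int_r2 by (simp add: power2_diff)
    show "integrable N (\<lambda>x. x ^ 8 / h\<^sup>2)"
      using m8(1) by simp
    fix x
    have "(1 - cosh_ratio h x)\<^sup>2 \<le> (x ^ 4 / h)\<^sup>2"
      using b(2,3)[OF h1, of x] by (intro power_mono) auto
    then show "(1 - cosh_ratio h x)\<^sup>2 \<le> x ^ 8 / h\<^sup>2"
      by (simp add: power_divide flip: power_mult)
  qed
  also have "\<dots> = 105 * h\<^sup>2"
    using h by (simp add: m8(2) power4_eq_xxxx power2_eq_square)
  finally have v: "1 - 2 * cosh_const h + (\<integral>x. (cosh_ratio h x)\<^sup>2 \<partial>N) \<le> 105 * h\<^sup>2"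
    using int_r int_r2 by (simp add: power2_diff c N.prob_space)
  \<comment> \<open>Uses \<open>2 * c - 1 \<le> c\<^sup>2\<close> for
    \<open>c = cosh_const h\<close>.\<close>
  have "(\<integral>x. (cosh_ratio h x)\<^sup>2 \<partial>N) \<le> (cosh_const h)\<^sup>2 + 105 * h\<^sup>2"
    using v zero_le_power2[of "1 - cosh_const h"] by (simp add: power2_diff)
  moreover have "1 / 4 \<le> (cosh_const h)\<^sup>2"
    using power_mono[OF c1, of 2] by (simp add: power2_eq_square)
  then have "105 * h\<^sup>2 \<le> 420 * h\<^sup>2 * (cosh_const h)\<^sup>2"
    using mult_left_mono[of "1/4" "(cosh_const h)\<^sup>2" "420 * h\<^sup>2"] by simp
  ultimately have "(\<integral>x. (cosh_ratio h x)\<^sup>2 \<partial>N) \<le> (1 + 420 * h\<^sup>2) * (cosh_const h)\<^sup>2"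
    by (simp add: algebra_simps)
  then have "(\<integral>x. (cosh_ratio h x)\<^sup>2 \<partial>N) / (cosh_const h)\<^sup>2 \<le> 1 + 420 * h\<^sup>2"
    using c1 by (simp add: pos_divide_le_eq)
  then show "(\<integral>x. ?p x * (cosh_ratio h x / cosh_const h)\<^sup>2 \<partial>lborel) \<le> 1 + 420 * h\<^sup>2"
    by (subst int_N[symmetric]) (simp_all add: power_divide)
qed

section \<open>Brownian motion on the grid and its reweighting to the hyperbolic cosine walk\<close>

definition grid :: "(real \<Rightarrow> 'a \<Rightarrow> real) \<Rightarrow> nat \<Rightarrow> real \<Rightarrow> 'a \<Rightarrow> nat \<Rightarrow> real" where
  "grid B n h \<omega> = (\<lambda>i\<in>{..<n}. B (real (Suc i) * h) \<omega>)"

context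
  fixes M :: "'a measure" and B :: "real \<Rightarrow> 'a \<Rightarrow> real" and n :: nat and h :: real
  assumes B: "std_BM M B" and n: "n > 0" and h: "h > 0"
begin

interpretation prob_space M
  using B by (simp add: std_BM_def)

lemma B_measurable: "s \<ge> 0 \<Longrightarrow> B s \<in> borel_measurable M"
  using B by (simp add: std_BM_def)

lemma grid_measurable: "grid B n h \<in> M \<rightarrow>\<^sub>M leb n"
  unfolding grid_def using h by (intro measurable_restrict) (auto intro: B_measurable)

definition step :: "nat \<Rightarrow> 'a \<Rightarrow> real" where
  "step i \<omega> = B (real (Suc i) * h) \<omega> - B (real i * h) \<omega>"

lemma step_measurable: "step i \<in> borel_measurable M"
  unfolding step_def using h by (intro borel_measurable_diff B_measurable) auto

lemma indep_step: "indep_vars (\<lambda>_. borel) step {..<n}"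
proof -
  \<comment> \<open>The \<open>n + 1\<close> grid times from 0 to \<open>n * h\<close> have
    \<open>n\<close> increments.\<close>
  define ts where "ts = map (\<lambda>k. real k * h) [0..<Suc n]"
  have "sorted ts" "distinct ts" "\<forall>x\<in>set ts. 0 \<le> x"
    using h by (auto simp: ts_def sorted_iff_nth_mono distinct_conv_nth nth_append mult_right_mono simp del: upt_Suc)
  then have "indep_vars (\<lambda>_. borel) (\<lambda>i \<omega>. B (ts ! Suc i) \<omega> - B (ts ! i) \<omega>) {..<length ts - 1}"
    using B unfolding std_BM_def by blast
  moreover have "length ts - 1 = n"
    by (simp add: ts_def)
  moreover have "ts ! i = real i * h" if "i \<le> n" for i
    using that by (simp add: ts_def del: upt_Suc)
  ultimately show ?thesis
    by (subst indep_vars_cong[OF refl, where Y="\<lambda>i \<omega>. B (ts ! Suc i) \<omega> - B (ts ! i) \<omega>"])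
      (auto simp: step_def fun_eq_iff)
qed

lemma distributed_step: "distributed M lborel (step i) (normal_density 0 (sqrt h))"
proof -
  have "real (Suc i) * h - real i * h = h"
    by (simp add: algebra_simps)
  moreover have "0 \<le> real i * h \<and> real i * h < real (Suc i) * h"
    using h by (simp add: mult_strict_right_mono)
  ultimately show ?thesis
    using B unfolding std_BM_def step_def by metis
qed

text \<open>Since the path starts at 0, the grid values are partial sums of independent Gaussian
  steps, and \<open>distr_partial_sums\<close> applies to their product density.\<close>

lemma distr_grid:
  "distr M (leb n) (grid B n h) =
    density (leb n) (\<lambda>v. \<Prod>i<n. ennreal (normal_density 0 (sqrt h) (v i - prev v i)))"
proof -
  let ?p = "\<lambda>x. ennreal (normal_density 0 (sqrt h) x)"
  have p: "prob_space (density lborel ?p)"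
    using h by (intro prob_space_normal_density) simp
  have law: "distr M borel (step i) = density lborel ?p" for i
    using distributed_distr_eq_density[OF distributed_step, of i]
    by (simp cong: distr_cong)
  have steps: "(\<lambda>\<omega>. \<lambda>i\<in>{..<n}. step i \<omega>) \<in> M \<rightarrow>\<^sub>M leb n"
    using step_measurable by (intro measurable_restrict) auto
  have "distr M (leb n) (\<lambda>\<omega>. \<lambda>i\<in>{..<n}. step i \<omega>) =
      distr M (PiM {..<n} (\<lambda>_. borel)) (\<lambda>\<omega>. \<lambda>i\<in>{..<n}. step i \<omega>)"
    by (intro distr_cong sets_PiM_cong) auto
  also have "\<dots> = PiM {..<n} (\<lambda>i. distr M borel (step i))"
    using indep_step n step_measurable by (subst (asm) indep_vars_iff_distr_eq_PiM') auto
  also have "\<dots> = density (leb n) (\<lambda>x. \<Prod>i<n. ?p (x i))"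
    unfolding law using p by (intro density_PiM_lborel) auto
  finally have law_steps: "distr M (leb n) (\<lambda>\<omega>. \<lambda>i\<in>{..<n}. step i \<omega>) =
      density (leb n) (\<lambda>x. \<Prod>i<n. ?p (x i))" .
  have "density (leb n) (\<lambda>v. \<Prod>i<n. ?p (v i - prev v i)) =
      distr (distr M (leb n) (\<lambda>\<omega>. \<lambda>i\<in>{..<n}. step i \<omega>)) (leb n)
        (\<lambda>x. \<lambda>i\<in>{..<n}. \<Sum>j\<le>i. x j)"
    unfolding law_steps by (rule distr_partial_sums[symmetric]) simp
  also have "\<dots> = distr M (leb n) ((\<lambda>x. \<lambda>i\<in>{..<n}. \<Sum>j\<le>i. x j) \<circ> (\<lambda>\<omega>. \<lambda>i\<in>{..<n}. step i \<omega>))"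
    using steps by (rule distr_distr[rotated])
      (auto intro!: measurable_restrict borel_measurable_sum leb_component)
  also have "\<dots> = distr M (leb n) (grid B n h)"
  proof (rule distr_cong)
    fix \<omega> assume "\<omega> \<in> space M"
    then have "B 0 \<omega> = 0"
      using B by (simp add: std_BM_def)
    then have "(\<Sum>j\<le>i. step j \<omega>) = B (real (Suc i) * h) \<omega>" for i
      by (induction i) (simp_all add: step_def)
    then show "((\<lambda>x. \<lambda>i\<in>{..<n}. \<Sum>j\<le>i. x j) \<circ> (\<lambda>\<omega>. \<lambda>i\<in>{..<n}. step i \<omega>)) \<omega> = grid B n h \<omega>"
      by (auto simp: grid_def fun_eq_iff)
  qed auto
  finally show ?thesis ..
qed

lemma cosh_dens_grid:
  "\<omega> \<in> space M \<Longrightarrow> cosh_dens n h (grid B n h \<omega>) = (\<Prod>i<n. cosh_ratio h (step i \<omega>) / cosh_const h)"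
  unfolding cosh_dens_def
proof (rule prod.cong)
  fix i assume "\<omega> \<in> space M" "i \<in> {..<n}"
  then show "cosh_ratio h (grid B n h \<omega> i - prev (grid B n h \<omega>) i) / cosh_const h =
      cosh_ratio h (step i \<omega>) / cosh_const h"
    using B by (cases i) (auto simp: grid_def step_def std_BM_def)
qed simp

lemma cosh_dens_measurable: "cosh_dens n h \<in> borel_measurable (leb n)"
  unfolding cosh_dens_def
  by (intro borel_measurable_prod borel_measurable_divide measurable_const
      measurable_compose[OF _ cosh_ratio_measurable] borel_measurable_diff prev_measurable leb_component)
    auto

lemma cosh_dens_nonneg: "0 \<le> cosh_dens n h v"
  unfolding cosh_dens_def cosh_const_def
  by (intro prod_nonneg divide_nonneg_nonneg ballI Bochner_Integration.integral_nonneg mult_nonneg_nonneg)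
    (auto simp: cosh_ratio_def)

text \<open>The quadratic term in \<open>cosh_ratio\<close> cancels the Gaussian exponent, so the
  reweighted density depends on the path only through its energy.\<close>

lemma normal_density_mult_cosh_dens:
  "(\<Prod>i<n. normal_density 0 (sqrt h) (v i - prev v i)) * cosh_dens n h v =
    exp (- (dE v (n - 1) - real n) / h) / (sqrt (2 * pi * h) * cosh_const h) ^ n"
proof -
  have "normal_density 0 (sqrt h) x * (cosh_ratio h x / cosh_const h) =
      exp (- (cosh x - 1) / h) / (sqrt (2 * pi * h) * cosh_const h)" for x
  proof -
    have "exp (- x\<^sup>2 / (2 * h)) * cosh_ratio h x = exp (- (cosh x - 1) / h)"
      using h by (simp add: cosh_ratio_def mult_exp_exp diff_divide_distrib add_divide_distrib)
    then show ?thesis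
      using h by (simp add: normal_density_def field_simps)
  qed
  then have "(\<Prod>i<n. normal_density 0 (sqrt h) (v i - prev v i)) * cosh_dens n h v =
      (\<Prod>i<n. exp (- (cosh (v i - prev v i) - 1) / h) / (sqrt (2 * pi * h) * cosh_const h))"
    by (simp add: cosh_dens_def flip: prod.distrib)
  also have "\<dots> = exp (\<Sum>i<n. - (cosh (v i - prev v i) - 1) / h) / (sqrt (2 * pi * h) * cosh_const h) ^ n"
    by (simp add: prod_dividef exp_sum)
  also have "(\<Sum>i<n. - (cosh (v i - prev v i) - 1) / h) = - (dE v (n - 1) - real n) / h"
  proof -
    have "{..n - 1} = {..<n}"
      using n by auto
    then have "dE v (n - 1) - real n = (\<Sum>i<n. cosh (v i - prev v i) - 1)"
      by (simp add: dE_def sum_subtractf)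
    then show ?thesis
      by (simp only: sum_negf sum_divide_distrib[symmetric])
  qed
  finally show ?thesis .
qed

text \<open>Exact invariance of the hyperbolic cosine walk: its Lebesgue density is a function of
  the energy, fixed by \<open>dE_dT\<close>, and Lebesgue measure is fixed by
  \<open>distr_dT\<close>.\<close>

lemma distr_dT_cosh_dens:
  "distr (density (distr M (leb n) (grid B n h)) (cosh_dens n h)) (leb n) (dT n h) =
    density (distr M (leb n) (grid B n h)) (cosh_dens n h)"
proof -
  define w where
    "w = (\<lambda>v. exp (- (dE v (n - 1) - real n) / h) / (sqrt (2 * pi * h) * cosh_const h) ^ n)"
  have w: "w \<in> borel_measurable (leb n)"
    unfolding w_def using n
    by (intro borel_measurable_divide borel_measurable_exp borel_measurable_uminus
        borel_measurable_diff dE_measurable measurable_const measurable_compose[OF _ borel_measurable_exp]) auto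
  have p: "(\<lambda>v. \<Prod>i<n. ennreal (normal_density 0 (sqrt h) (v i - prev v i))) \<in> borel_measurable (leb n)"
    by (intro borel_measurable_prod_ennreal measurable_compose[OF _ measurable_ennreal]
        measurable_compose[OF _ borel_measurable_normal_density] borel_measurable_diff
        prev_measurable leb_component) auto
  have "density (distr M (leb n) (grid B n h)) (cosh_dens n h) = density (leb n) (\<lambda>v. ennreal (w v))"
  proof -
    have "(\<Prod>i<n. ennreal (normal_density 0 (sqrt h) (v i - prev v i))) * ennreal (cosh_dens n h v) =
        ennreal (w v)" for v
      using normal_density_mult_cosh_dens[of v]
      by (simp add: w_def prod_ennreal cosh_dens_nonneg prod_nonneg flip: ennreal_mult)
    then show ?thesis
      unfolding distr_grid using p cosh_dens_measurable by (subst density_density_eq) auto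
  qed
  moreover have "distr (density (leb n) (\<lambda>v. ennreal (w v))) (leb n) (dT n h) = density (leb n) (\<lambda>v. ennreal (w v))"
  proof -
    have "distr (density (leb n) (\<lambda>v. ennreal (w (dT n h v)))) (leb n) (dT n h) =
        density (distr (leb n) (leb n) (dT n h)) (\<lambda>v. ennreal (w v))"
      using w dT_measurable by (intro density_distr[symmetric]) auto
    moreover have "w (dT n h v) = w v" for v
      unfolding w_def dE_dT[OF h n] ..
    ultimately show ?thesis
      by (simp add: distr_dT h n)
  qed
  ultimately show ?thesis
    by simp
qed

lemma integral_cosh_dens_dT:
  fixes G :: "(nat \<Rightarrow> real) \<Rightarrow> real"
  assumes G: "G \<in> borel_measurable (leb n)"
  shows "(\<integral>\<omega>. cosh_dens n h (grid B n h \<omega>) * G (dT n h (grid B n h \<omega>)) \<partial>M) =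
    (\<integral>\<omega>. cosh_dens n h (grid B n h \<omega>) * G (grid B n h \<omega>) \<partial>M)"
proof -
  let ?Q = "density (distr M (leb n) (grid B n h)) (cosh_dens n h)"
  have int_Q: "(\<integral>v. F v \<partial>?Q) = (\<integral>\<omega>. cosh_dens n h (grid B n h \<omega>) * F (grid B n h \<omega>) \<partial>M)"
    if F: "F \<in> borel_measurable (leb n)" for F :: "(nat \<Rightarrow> real) \<Rightarrow> real"
  proof -
    have "(\<integral>v. F v \<partial>?Q) = (\<integral>v. cosh_dens n h v * F v \<partial>distr M (leb n) (grid B n h))"
      using F cosh_dens_measurable cosh_dens_nonneg by (subst integral_density) auto
    also have "\<dots> = (\<integral>\<omega>. cosh_dens n h (grid B n h \<omega>) * F (grid B n h \<omega>) \<partial>M)"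
      using F cosh_dens_measurable grid_measurable by (intro integral_distr) auto
    finally show ?thesis .
  qed
  have "(\<integral>v. G (dT n h v) \<partial>?Q) = (\<integral>v. G v \<partial>distr ?Q (leb n) (dT n h))"
    using G dT_measurable by (intro integral_distr[symmetric]) simp_all
  also have "\<dots> = (\<integral>v. G v \<partial>?Q)"
    unfolding distr_dT_cosh_dens ..
  finally show ?thesis
    using int_Q[OF G] int_Q[OF measurable_compose[OF dT_measurable G]] by simp
qed

text \<open>Independence factorises the moments of the density into single-step moments, which
  \<open>cosh_ratio_moments\<close> supplies. Each factor is at most 2 because
  \<open>cosh_const h \<ge> 1 / 2\<close>.\<close>

lemma
  assumes h6: "h \<le> 1 / 6"
  shows integrable_cosh_dens: "integrable M (\<lambda>\<omega>. cosh_dens n h (grid B n h \<omega>))"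
    and expectation_cosh_dens: "expectation (\<lambda>\<omega>. cosh_dens n h (grid B n h \<omega>)) = 1"
    and integrable_cosh_dens_square: "integrable M (\<lambda>\<omega>. (cosh_dens n h (grid B n h \<omega>))\<^sup>2)"
    and expectation_cosh_dens_square:
      "expectation (\<lambda>\<omega>. (cosh_dens n h (grid B n h \<omega>))\<^sup>2) \<le> (1 + 420 * h\<^sup>2) ^ n"
proof -
  note c = cosh_ratio_moments[OF h h6] and b = cosh_ratio_bounds[of h]
  define f where "f = (\<lambda>x. cosh_ratio h x / cosh_const h)"
  have f [measurable]: "f \<in> borel_measurable borel"
    unfolding f_def by measurable
  have f_bound: "\<bar>f x\<bar> \<le> 2" for x
    using b(1,2)[of x] c(1) h h6 by (auto simp: f_def field_simps abs_mult)
  have f2_bound: "\<bar>(f x)\<^sup>2\<bar> \<le> 4" for x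
    using power_mono[OF f_bound[of x], of 2] by simp
  have ind: "indep_vars (\<lambda>_. borel) (\<lambda>i \<omega>. F (step i \<omega>)) {..<n}"
    if "F \<in> borel_measurable borel" for F :: "real \<Rightarrow> real"
    using indep_vars_compose2[OF indep_step, of "\<lambda>_. F"] that by simp
  have ible: "integrable M (\<lambda>\<omega>. F (step i \<omega>))"
    if "F \<in> borel_measurable borel" "\<And>x. \<bar>F x\<bar> \<le> C" for F :: "real \<Rightarrow> real" and C i
    using that measurable_compose[OF step_measurable that(1)]
    by (intro integrable_const_bound[where B=C]) auto
  have ex: "(\<integral>\<omega>. F (step i \<omega>) \<partial>M) = (\<integral>x. normal_density 0 (sqrt h) x * F x \<partial>lborel)"
    if "F \<in> borel_measurable borel" for F :: "real \<Rightarrow> real" and i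
    using distributed_integral[OF distributed_step, of F i] that by simp
  have f2 [measurable]: "(\<lambda>x. (f x)\<^sup>2) \<in> borel_measurable borel"
    by measurable
  have D: "cosh_dens n h (grid B n h \<omega>) = (\<Prod>i<n. f (step i \<omega>))" if "\<omega> \<in> space M" for \<omega>
    using that by (simp add: cosh_dens_grid f_def)
  then have D2: "(cosh_dens n h (grid B n h \<omega>))\<^sup>2 = (\<Prod>i<n. (f (step i \<omega>))\<^sup>2)" if "\<omega> \<in> space M" for \<omega>
    using that by (simp add: prod_power_distrib)
  have fin: "finite {..<n}" by simp
  show "integrable M (\<lambda>\<omega>. cosh_dens n h (grid B n h \<omega>))"
    using indep_vars_integrable[OF fin ind[OF f] ible[OF f f_bound]]
    by (simp add: D cong: Bochner_Integration.integrable_cong)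
  show "integrable M (\<lambda>\<omega>. (cosh_dens n h (grid B n h \<omega>))\<^sup>2)"
    using indep_vars_integrable[OF fin ind[OF f2] ible[OF f2 f2_bound]]
    by (simp add: D2 cong: Bochner_Integration.integrable_cong)
  have "(\<integral>x. normal_density 0 (sqrt h) x * f x \<partial>lborel) = cosh_const h / cosh_const h"
    by (simp add: f_def cosh_const_def)
  then have "(\<integral>x. normal_density 0 (sqrt h) x * f x \<partial>lborel) = 1"
    using c(1) by simp
  then show "expectation (\<lambda>\<omega>. cosh_dens n h (grid B n h \<omega>)) = 1"
    using indep_vars_lebesgue_integral[OF fin ind[OF f] ible[OF f f_bound]]
    by (simp add: D ex[OF f] cong: Bochner_Integration.integral_cong)
  have "expectation (\<lambda>\<omega>. (cosh_dens n h (grid B n h \<omega>))\<^sup>2) =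
      (\<integral>x. normal_density 0 (sqrt h) x * (f x)\<^sup>2 \<partial>lborel) ^ n"
    using indep_vars_lebesgue_integral[OF fin ind[OF f2] ible[OF f2 f2_bound]]
    by (simp add: D2 ex[OF f2] cong: Bochner_Integration.integral_cong)
  also have "\<dots> \<le> (1 + 420 * h\<^sup>2) ^ n"
    using c(3) by (intro power_mono) (auto simp: f_def intro!: Bochner_Integration.integral_nonneg)
  finally show "expectation (\<lambda>\<omega>. (cosh_dens n h (grid B n h \<omega>))\<^sup>2) \<le> (1 + 420 * h\<^sup>2) ^ n" .
qed

text \<open>By exact invariance \<open>D * X\<close> and \<open>D * Y\<close> have the same mean, so
  the difference of the means of \<open>X\<close> and \<open>Y\<close> is that of
  \<open>(1 - D) * (X - Y)\<close>. As \<open>\<bar>X - Y\<bar> \<le> 1\<close>, it is bounded by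
  the mean of \<open>\<bar>D - 1\<bar>\<close>, and then by the root of the variance of
  \<open>D\<close>.\<close>

lemma expectation_dT_approx:
  fixes G :: "(nat \<Rightarrow> real) \<Rightarrow> real"
  assumes h6: "h \<le> 1 / 6" and G: "G \<in> borel_measurable (leb n)" and G01: "\<And>v. 0 \<le> G v" "\<And>v. G v \<le> 1"
  shows "\<bar>expectation (\<lambda>\<omega>. G (dT n h (grid B n h \<omega>))) - expectation (\<lambda>\<omega>. G (grid B n h \<omega>))\<bar>
    \<le> sqrt ((1 + 420 * h\<^sup>2) ^ n - 1)"
proof -
  define D where "D \<omega> = cosh_dens n h (grid B n h \<omega>)" for \<omega>
  define X where "X = (\<lambda>\<omega>. G (dT n h (grid B n h \<omega>)))"
  define Y where "Y = (\<lambda>\<omega>. G (grid B n h \<omega>))"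
  note D_props = integrable_cosh_dens[OF h6] expectation_cosh_dens[OF h6]
    integrable_cosh_dens_square[OF h6] expectation_cosh_dens_square[OF h6]
  note D_props = D_props[folded D_def]
  have X: "X \<in> borel_measurable M" and Y: "Y \<in> borel_measurable M"
    unfolding X_def Y_def
    using grid_measurable dT_measurable G by (auto intro: measurable_compose)
  have XY: "integrable M X" "integrable M Y"
    using X Y G01 by (auto intro!: integrable_const_bound[where B=1] simp: X_def Y_def)
  have DXY: "integrable M (\<lambda>\<omega>. D \<omega> * X \<omega>)" "integrable M (\<lambda>\<omega>. D \<omega> * Y \<omega>)"
    using X Y D_props(1) G01
    by (auto intro!: Bochner_Integration.integrable_bound[OF D_props(1)] AE_I2 mult_left_le
      simp: X_def Y_def abs_mult)
  have eq: "expectation (\<lambda>\<omega>. D \<omega> * X \<omega>) = expectation (\<lambda>\<omega>. D \<omega> * Y \<omega>)"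
    unfolding D_def X_def Y_def by (rule integral_cosh_dens_dT[OF G])
  have expand: "(1 - D \<omega>) * (X \<omega> - Y \<omega>) = (X \<omega> - Y \<omega>) - (D \<omega> * X \<omega> - D \<omega> * Y \<omega>)" for \<omega>
    by (simp add: algebra_simps)
  have int: "integrable M (\<lambda>\<omega>. (1 - D \<omega>) * (X \<omega> - Y \<omega>))"
    unfolding expand using XY DXY by (intro Bochner_Integration.integrable_diff)
  have "expectation X - expectation Y = expectation (\<lambda>\<omega>. (1 - D \<omega>) * (X \<omega> - Y \<omega>))"
    unfolding expand using XY DXY eq by simp
  then have "\<bar>expectation X - expectation Y\<bar> \<le> expectation (\<lambda>\<omega>. \<bar>(1 - D \<omega>) * (X \<omega> - Y \<omega>)\<bar>)"
    using integral_abs_bound[of M "\<lambda>\<omega>. (1 - D \<omega>) * (X \<omega> - Y \<omega>)"] by simp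
  also have "\<dots> \<le> expectation (\<lambda>\<omega>. \<bar>D \<omega> - 1\<bar>)"
  proof (rule integral_mono)
    show "integrable M (\<lambda>\<omega>. \<bar>(1 - D \<omega>) * (X \<omega> - Y \<omega>)\<bar>)"
      using int by (rule integrable_abs)
    show "integrable M (\<lambda>\<omega>. \<bar>D \<omega> - 1\<bar>)"
      using D_props(1) by simp
    fix \<omega>
    have "\<bar>X \<omega> - Y \<omega>\<bar> \<le> 1"
      using G01[of "dT n h (grid B n h \<omega>)"] G01[of "grid B n h \<omega>"] unfolding X_def Y_def by linarith
    then show "\<bar>(1 - D \<omega>) * (X \<omega> - Y \<omega>)\<bar> \<le> \<bar>D \<omega> - 1\<bar>"
      by (simp add: abs_mult abs_minus_commute mult_left_le)
  qed
  also have "\<dots> \<le> sqrt (expectation (\<lambda>\<omega>. (D \<omega>)\<^sup>2) - 1)"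
  proof (rule real_le_rsqrt)
    have int2: "integrable M (\<lambda>\<omega>. \<bar>D \<omega> - 1\<bar>\<^sup>2)"
      using D_props by (simp add: power2_diff)
    \<comment> \<open>Cauchy-Schwarz in the form that \<open>\<bar>D - 1\<bar>\<close> has
      nonnegative variance; \<open>D\<close> has mean 1.\<close>
    have "0 \<le> variance (\<lambda>\<omega>. \<bar>D \<omega> - 1\<bar>)"
      by (rule variance_positive)
    also have "\<dots> = expectation (\<lambda>\<omega>. \<bar>D \<omega> - 1\<bar>\<^sup>2) - (expectation (\<lambda>\<omega>. \<bar>D \<omega> - 1\<bar>))\<^sup>2"
      using D_props int2 by (intro variance_eq) auto
    also have "expectation (\<lambda>\<omega>. \<bar>D \<omega> - 1\<bar>\<^sup>2) = expectation (\<lambda>\<omega>. (D \<omega>)\<^sup>2) - 1"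
      using D_props by (simp add: power2_diff prob_space)
    finally show "(expectation (\<lambda>\<omega>. \<bar>D \<omega> - 1\<bar>))\<^sup>2 \<le> expectation (\<lambda>\<omega>. (D \<omega>)\<^sup>2) - 1"
      by simp
  qed
  also have "\<dots> \<le> sqrt ((1 + 420 * h\<^sup>2) ^ n - 1)"
    using D_props(4) by (intro real_sqrt_le_mono) simp
  finally show ?thesis
    by (simp add: X_def Y_def)
qed

end

section \<open>Passage to the limit\<close>

text \<open>Since index \<open>k\<close> stands for time \<open>(k + 1) * t / n\<close>, this
  selects the right end of the cell containing \<open>s\<close>. The cap sends \<open>s = t\<close>
  to the last index.\<close>

definition grid_index :: "real \<Rightarrow> nat \<Rightarrow> real \<Rightarrow> nat" where
  "grid_index t n s = min (nat \<lfloor>real n * s / t\<rfloor>) (n - 1)"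

lemma grid_index_less: "n > 0 \<Longrightarrow> grid_index t n s < n"
  by (auto simp: grid_index_def)

lemma grid_index_last: "n > 0 \<Longrightarrow> t > 0 \<Longrightarrow> grid_index t n t = n - 1"
  by (simp add: grid_index_def)

lemma grid_index_range:
  assumes "n > 0" "t > 0"
  shows "real (Suc (grid_index t n s)) * (t / n) \<in> {0..t}"
proof -
  have "real (Suc (grid_index t n s)) * (t / n) \<le> real n * (t / n)"
    using grid_index_less[of n t s] assms by (intro mult_right_mono) auto
  then show ?thesis using assms by simp
qed

lemma grid_index_approx:
  assumes "t > 0" "0 \<le> s" "s \<le> t" "n > 0"
  shows "\<bar>real (Suc (grid_index t n s)) * (t / n) - s\<bar> \<le> t / n"
proof -
  define x where "x = real n * s / t"
  have s: "s = x * (t / n)"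
    using assms by (simp add: x_def)
  have x: "0 \<le> x" "x \<le> n"
    using assms by (auto simp: x_def divide_le_eq)
  have "\<bar>real (Suc (grid_index t n s)) - x\<bar> \<le> 1"
  proof (cases "nat \<lfloor>x\<rfloor> \<le> n - 1")
    case True
    then have "grid_index t n s = nat \<lfloor>x\<rfloor>"
      by (simp add: grid_index_def x_def)
    then have "real (grid_index t n s) = of_int \<lfloor>x\<rfloor>"
      using x by simp
    then show ?thesis
      by (simp add: abs_le_iff) linarith
  next
    case False
    then have "n \<le> nat \<lfloor>x\<rfloor>"
      using assms by linarith
    then have "x = n"
      using x by linarith
    moreover have "grid_index t n s = n - 1"
      using False by (simp add: grid_index_def x_def)
    ultimately show ?thesis
      using assms by (simp add: of_nat_diff)
  qed
  then have "\<bar>(real (Suc (grid_index t n s)) - x) * (t / n)\<bar> \<le> 1 * (t / n)"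
    using assms unfolding abs_mult by (intro mult_mono) auto
  then show ?thesis
    by (simp only: left_diff_distrib s[symmetric] mult_1_left)
qed

lemma grid_index_tendsto:
  assumes "t > 0" "0 \<le> s" "s \<le> t"
  shows "(\<lambda>n. real (Suc (grid_index t n s)) * (t / n)) \<longlonglongrightarrow> s"
proof -
  have "(\<lambda>n. t / real n) \<longlonglongrightarrow> 0"
    by (rule lim_const_over_n)
  moreover have "eventually (\<lambda>n. norm (real (Suc (grid_index t n s)) * (t / n) - s) \<le> t / n) sequentially"
    using eventually_gt_at_top[of 0] by eventually_elim (use grid_index_approx assms in auto)
  ultimately have "(\<lambda>n. real (Suc (grid_index t n s)) * (t / n) - s) \<longlonglongrightarrow> 0"
    by (rule Lim_null_comparison[rotated])
  then show ?thesis
    by (rule LIM_zero_cancel)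
qed

section \<open>Pathwise convergence of the discretised transformation\<close>

context
  fixes \<phi> :: "real \<Rightarrow> real" and t :: real
  assumes cont: "continuous_on {0..t} \<phi>" and zero: "\<phi> 0 = 0" and t: "t > 0"
begin

abbreviation samples :: "nat \<Rightarrow> nat \<Rightarrow> real" where
  "samples n \<equiv> (\<lambda>i\<in>{..<n}. \<phi> (real (Suc i) * (t / n)))"

lemma exp_integrable:
  assumes "0 \<le> a" "b \<le> t"
  shows "(\<lambda>u. exp (2 * \<phi> u)) integrable_on {a..b}" "continuous_on {a..b} (\<lambda>u. exp (2 * \<phi> u))"
proof -
  show "continuous_on {a..b} (\<lambda>u. exp (2 * \<phi> u))"
    using assms by (intro continuous_intros continuous_on_subset[OF cont]) auto
  then show "(\<lambda>u. exp (2 * \<phi> u)) integrable_on {a..b}"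
    by (rule integrable_continuous_interval)
qed

lemma A_fun_continuous: "continuous_on {0..t} (A_fun \<phi>)"
  unfolding A_fun_def using t exp_integrable(1)[of 0 t] by (intro indefinite_integral_continuous_1) simp

lemma A_fun_bounds:
  assumes "0 \<le> s" "s \<le> t"
  shows "0 \<le> A_fun \<phi> s" "A_fun \<phi> s \<le> A_fun \<phi> t"
proof -
  show "0 \<le> A_fun \<phi> s"
    unfolding A_fun_def using assms
    by (intro Henstock_Kurzweil_Integration.integral_nonneg exp_integrable(1)) auto
  show "A_fun \<phi> s \<le> A_fun \<phi> t"
    unfolding A_fun_def using assms by (intro integral_subset_le exp_integrable(1)) auto
qed

lemma A_fun_pos: "A_fun \<phi> t > 0"
proof -
  obtain m where m: "m \<in> {0..t}" "\<And>u. u \<in> {0..t} \<Longrightarrow> exp (2 * \<phi> m) \<le> exp (2 * \<phi> u)"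
    using continuous_attains_inf[of "{0..t}" "\<lambda>u. exp (2 * \<phi> u)"] exp_integrable(2)[of 0 t] t by auto
  have "0 < exp (2 * \<phi> m) * t"
    using t by simp
  also have "\<dots> = integral {0..t} (\<lambda>_. exp (2 * \<phi> m))"
    using t by simp
  also have "\<dots> \<le> A_fun \<phi> t"
    unfolding A_fun_def using m(2) exp_integrable(1)[of 0 t] by (intro integral_le) auto
  finally show ?thesis .
qed

lemma dA_samples:
  assumes "k < n"
  shows "dA (t / n) (samples n) k =
    t / n * (\<Sum>j<Suc k. exp (\<phi> (real (Suc j) * (t / n)) + \<phi> (real j * (t / n))))"
  unfolding dA_def lessThan_Suc_atMost
proof (intro arg_cong2[of _ _ _ _ "(*)"] refl sum.cong)
  fix j assume "j \<in> {..k}"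
  then show "exp (samples n j + prev (samples n) j) =
      exp (\<phi> (real (Suc j) * (t / n)) + \<phi> (real j * (t / n)))"
    using assms zero by (cases j) auto
qed

text \<open>On each cell the sampled value is within \<open>\<epsilon>\<close> of the integrand, so
  the error grows by at most \<open>\<epsilon> * (t / n)\<close> per cell. The two endpoints are
  separate variables in the hypothesis because the sample mixes them.\<close>

lemma trapezoid_error:
  fixes n m :: nat
  assumes n: "n > 0" and m: "m \<le> n"
    and \<epsilon>: "\<And>x y u. x \<in> {0..t} \<Longrightarrow> y \<in> {0..t} \<Longrightarrow> u \<in> {0..t} \<Longrightarrow> \<bar>x - u\<bar> \<le> t / n \<Longrightarrow>
      \<bar>y - u\<bar> \<le> t / n \<Longrightarrow> \<bar>exp (\<phi> x + \<phi> y) - exp (2 * \<phi> u)\<bar> \<le> \<epsilon>"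
  shows "\<bar>t / n * (\<Sum>j<m. exp (\<phi> (real (Suc j) * (t / n)) + \<phi> (real j * (t / n)))) - A_fun \<phi> (real m * (t / n))\<bar>
    \<le> \<epsilon> * (real m * (t / n))"
  using m
proof (induction m)
  case 0
  then show ?case by (simp add: A_fun_def)
next
  case (Suc m)
  define h where "h = t / n"
  define a where "a = real m * h"
  define b where "b = real (Suc m) * h"
  define e where "e = exp (\<phi> b + \<phi> a)"
  have h: "h > 0" using n t by (simp add: h_def)
  have ab: "0 \<le> a" "a \<le> b" "b - a = h"
    using h by (auto simp: a_def b_def algebra_simps)
  have "b \<le> real n * h"
    unfolding b_def using Suc.prems h by (intro mult_right_mono) auto
  then have bt: "b \<le> t"
    using n by (simp add: h_def)
  have split: "A_fun \<phi> b = A_fun \<phi> a + integral {a..b} (\<lambda>u. exp (2 * \<phi> u))"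
    unfolding A_fun_def using Henstock_Kurzweil_Integration.integral_combine[OF ab(1,2) exp_integrable(1)[OF order_refl bt]] by simp
  have "norm (integral {a..b} (\<lambda>u. e - exp (2 * \<phi> u))) \<le> \<epsilon> * (b - a)"
  proof (rule integral_bound)
    show "continuous_on {a..b} (\<lambda>u. e - exp (2 * \<phi> u))"
      using ab bt by (intro continuous_on_diff continuous_on_const exp_integrable(2))
    fix u assume "u \<in> {a..b}"
    then show "norm (e - exp (2 * \<phi> u)) \<le> \<epsilon>"
      unfolding e_def real_norm_def using ab bt by (intro \<epsilon>) (auto simp: h_def)
  qed (use ab in simp)
  also have "integral {a..b} (\<lambda>u. e - exp (2 * \<phi> u)) = h * e - integral {a..b} (\<lambda>u. exp (2 * \<phi> u))"
    using ab bt exp_integrable(1) by (subst Henstock_Kurzweil_Integration.integral_diff) auto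
  finally have "\<bar>h * e - integral {a..b} (\<lambda>u. exp (2 * \<phi> u))\<bar> \<le> \<epsilon> * h"
    by (simp add: ab)
  moreover have "\<bar>h * (\<Sum>j<m. exp (\<phi> (real (Suc j) * h) + \<phi> (real j * h))) - A_fun \<phi> a\<bar> \<le> \<epsilon> * a"
    using Suc by (simp add: h_def a_def)
  moreover have "h * (\<Sum>j<Suc m. exp (\<phi> (real (Suc j) * h) + \<phi> (real j * h))) =
      h * (\<Sum>j<m. exp (\<phi> (real (Suc j) * h) + \<phi> (real j * h))) + h * e"
    by (simp add: e_def a_def b_def algebra_simps)
  moreover have "\<epsilon> * b = \<epsilon> * a + \<epsilon> * h"
    using ab(3) by (simp flip: distrib_left)
  ultimately show ?case
    unfolding h_def[symmetric] b_def[symmetric] split by linarith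
qed

text \<open>The quadrature error at the selected grid time tends to 0, and continuity of
  \<open>A_fun\<close> moves that grid time to \<open>s\<close>.\<close>

lemma dA_tendsto:
  assumes s: "0 \<le> s" "s \<le> t"
  shows "(\<lambda>n. dA (t / n) (samples n) (grid_index t n s)) \<longlonglongrightarrow> A_fun \<phi> s"
proof -
  let ?\<tau> = "\<lambda>n. real (Suc (grid_index t n s)) * (t / real n)"
  have \<tau>: "eventually (\<lambda>n. ?\<tau> n \<in> {0..t}) sequentially"
    using eventually_gt_at_top[of 0] by eventually_elim (rule grid_index_range[OF _ t])
  have "(\<lambda>n. A_fun \<phi> (?\<tau> n)) \<longlonglongrightarrow> A_fun \<phi> s"
    using continuous_on_tendsto_compose[OF A_fun_continuous grid_index_tendsto[OF t s] _ \<tau>] s by simp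
  note A_lim = this
  have "(\<lambda>n. dA (t / n) (samples n) (grid_index t n s) - A_fun \<phi> (?\<tau> n)) \<longlonglongrightarrow> 0"
  proof (rule LIMSEQ_I)
    fix r :: real assume r: "r > 0"
    \<comment> \<open>Over total length at most \<open>t\<close> the accumulated error is then at
      most \<open>r / 2\<close>.\<close>
    define \<epsilon> where "\<epsilon> = r / (2 * t)"
    have \<epsilon>: "\<epsilon> > 0" using r t by (simp add: \<epsilon>_def)
    \<comment> \<open>Uniform continuity in two variables compares the pair of cell endpoints with
      the diagonal point \<open>(u, u)\<close>, whose value is the integrand.\<close>
    have "uniformly_continuous_on ({0..t} \<times> {0..t}) (\<lambda>p. exp (\<phi> (fst p) + \<phi> (snd p)))"
      by (intro compact_uniformly_continuous compact_Times compact_Icc continuous_intros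
          continuous_on_compose2[OF cont]) auto
    then obtain \<delta> where \<delta>: "\<delta> > 0"
      "\<And>p q. p \<in> {0..t} \<times> {0..t} \<Longrightarrow> q \<in> {0..t} \<times> {0..t} \<Longrightarrow> dist q p < \<delta> \<Longrightarrow>
        dist (exp (\<phi> (fst q) + \<phi> (snd q))) (exp (\<phi> (fst p) + \<phi> (snd p))) < \<epsilon>"
      using \<epsilon> unfolding uniformly_continuous_on_def by metis
    \<comment> \<open>Half of \<open>\<delta>\<close> for each coordinate distance, since the
      distance of pairs is bounded by their sum.\<close>
    have "eventually (\<lambda>n. t / real n < \<delta> / 2) sequentially"
      using lim_const_over_n[of t] \<delta>(1) by (intro order_tendstoD) auto
    then have "eventually (\<lambda>n. norm (dA (t / n) (samples n) (grid_index t n s) - A_fun \<phi> (?\<tau> n) - 0) < r) sequentially"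
      using eventually_gt_at_top[of 0] \<tau>
    proof eventually_elim
      case (elim n)
      have "\<bar>exp (\<phi> x + \<phi> y) - exp (2 * \<phi> u)\<bar> \<le> \<epsilon>"
        if "x \<in> {0..t}" "y \<in> {0..t}" "u \<in> {0..t}" "\<bar>x - u\<bar> \<le> t / n" "\<bar>y - u\<bar> \<le> t / n" for x y u
      proof -
        have "dist (x, y) (u, u) \<le> dist x u + dist y u"
          unfolding dist_Pair_Pair by (intro sqrt_sum_squares_le_sum) auto
        also have "\<dots> < \<delta>"
          unfolding dist_real_def using that(4,5) elim(1) by linarith
        finally show ?thesis
          using \<delta>(2)[of "(u, u)" "(x, y)"] that by (simp add: dist_real_def)
      qed
      then have "\<bar>dA (t / n) (samples n) (grid_index t n s) - A_fun \<phi> (?\<tau> n)\<bar> \<le> \<epsilon> * ?\<tau> n"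
        unfolding dA_samples[OF grid_index_less[OF elim(2)]]
        using grid_index_less[OF elim(2), of t s] elim(2) by (intro trapezoid_error) auto
      also have "\<dots> \<le> \<epsilon> * t"
        using elim(3) \<epsilon> by (intro mult_left_mono) auto
      also have "\<dots> < r"
        using r t by (simp add: \<epsilon>_def)
      finally show ?case by simp
    qed
    then show "\<exists>n0. \<forall>n\<ge>n0. norm (dA (t / n) (samples n) (grid_index t n s) - A_fun \<phi> (?\<tau> n) - 0) < r"
      by (simp add: eventually_sequentially)
  qed
  from tendsto_add[OF this A_lim] show ?thesis
    by simp
qed

lemma samples_tendsto:
  assumes s: "0 \<le> s" "s \<le> t"
  shows "(\<lambda>n. samples n (grid_index t n s)) \<longlonglongrightarrow> \<phi> s"
proof -
  let ?\<tau> = "\<lambda>n. real (Suc (grid_index t n s)) * (t / real n)"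
  have \<tau>: "eventually (\<lambda>n. ?\<tau> n \<in> {0..t}) sequentially"
    using eventually_gt_at_top[of 0] by eventually_elim (rule grid_index_range[OF _ t])
  have "(\<lambda>n. \<phi> (?\<tau> n)) \<longlonglongrightarrow> \<phi> s"
    using continuous_on_tendsto_compose[OF cont grid_index_tendsto[OF t s] _ \<tau>] s by simp
  moreover have "eventually (\<lambda>n. \<phi> (?\<tau> n) = samples n (grid_index t n s)) sequentially"
    using eventually_gt_at_top[of 0] by eventually_elim (simp add: grid_index_less)
  ultimately show ?thesis
    by (rule Lim_transform_eventually)
qed

text \<open>All ingredients converge; the logarithm passes to the limit because its limiting
  argument is again a convex combination of positive numbers.\<close>

lemma dT_tendsto:
  assumes s: "0 \<le> s" "s \<le> t"
  shows "(\<lambda>n. dT n (t / n) (samples n) (grid_index t n s)) \<longlonglongrightarrow> calT t \<phi> s"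
proof -
  define r where "r = A_fun \<phi> s / A_fun \<phi> t"
  have r: "0 \<le> r" "r \<le> 1"
    using A_fun_bounds[OF s] A_fun_pos by (auto simp: r_def)
  have "1 + r * (exp (2 * \<phi> t) - 1) = (1 - r) + r * exp (2 * \<phi> t)"
    by (simp add: algebra_simps)
  also have "\<dots> > 0"
    using r by (cases "r = 0") (auto intro!: add_nonneg_pos)
  finally have pos: "1 + A_fun \<phi> s * ((exp (2 * \<phi> t) - 1) / A_fun \<phi> t) > 0"
    by (simp add: r_def)
  have tt: "0 \<le> t" "t \<le> t" using t by auto
  \<comment> \<open>The index \<open>n - 1\<close> read by \<open>dc\<close> is the grid index of
    \<open>t\<close>, so the convergence results at time \<open>t\<close> cover it.\<close>
  let ?i = "\<lambda>n. grid_index t n s" and ?l = "\<lambda>n. grid_index t n t"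
  have "(\<lambda>n. samples n (?i n) - ln (1 + dA (t / n) (samples n) (?i n) *
      ((exp (2 * samples n (?l n)) - 1) / dA (t / n) (samples n) (?l n)))) \<longlonglongrightarrow>
      \<phi> s - ln (1 + A_fun \<phi> s * ((exp (2 * \<phi> t) - 1) / A_fun \<phi> t))"
    using A_fun_pos pos
    by (intro tendsto_intros samples_tendsto[OF s] samples_tendsto[OF tt] dA_tendsto[OF s] dA_tendsto[OF tt]) auto
  moreover have "\<phi> s - ln (1 + A_fun \<phi> s * ((exp (2 * \<phi> t) - 1) / A_fun \<phi> t)) = calT t \<phi> s"
    by (simp add: calT_def bbT_def)
  moreover have "eventually (\<lambda>n. samples n (?i n) - ln (1 + dA (t / n) (samples n) (?i n) *
      ((exp (2 * samples n (?l n)) - 1) / dA (t / n) (samples n) (?l n))) =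
      dT n (t / n) (samples n) (?i n)) sequentially"
    using eventually_gt_at_top[of 0]
    by eventually_elim (simp add: grid_index_less grid_index_last t dT_def dc_def)
  ultimately show ?thesis
    by (simp only: Lim_transform_eventually)
qed

end

section \<open>Test functions determining finite-dimensional laws\<close>

text \<open>Lower orthants are stable under intersection, generate the product sigma-algebra and
  exhaust the space, so Dynkin uniqueness applies.\<close>

lemma measure_eqI_PiM_atMost:
  fixes \<mu> \<nu> :: "('i \<Rightarrow> real) measure"
  assumes I: "finite I" and \<mu>: "sets \<mu> = sets (PiM I (\<lambda>_. borel))" and \<nu>: "sets \<nu> = sets (PiM I (\<lambda>_. borel))"
    and fin: "finite_measure \<mu>"
    and eq: "\<And>a. emeasure \<mu> {f \<in> PiE I (\<lambda>_. UNIV). \<forall>i\<in>I. f i \<le> a i} =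
      emeasure \<nu> {f \<in> PiE I (\<lambda>_. UNIV). \<forall>i\<in>I. f i \<le> a i}"
  shows "\<mu> = \<nu>"
proof -
  let ?\<Omega> = "PiE I (\<lambda>_. UNIV :: real set)"
  define R where "R a = {f \<in> ?\<Omega>. \<forall>i\<in>I. f i \<le> a i}" for a :: "'i \<Rightarrow> real"
  have "sets (PiM I (\<lambda>_. borel :: real measure)) = sets (PiM I (\<lambda>_. sigma UNIV (range atMost)))"
    by (simp flip: borel_eq_atMost)
  \<comment> \<open>The index set is taken as a single block \<open>{I}\<close>, so the generators
    are boxes constrained in every coordinate.\<close>
  also have "\<dots> = sets (sigma ?\<Omega>
      {{f \<in> ?\<Omega>. \<forall>i\<in>j. f i \<in> A i} | A j. j \<in> {I} \<and> A \<in> Pi j (\<lambda>_. range atMost)})"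
  proof (rule sets_PiM_sigma)
    fix i :: 'i
    have "range (\<lambda>n::nat. {..real n}) \<subseteq> range atMost" "(UNIV :: real set) = \<Union> (range (\<lambda>n::nat. {..real n}))"
      using real_arch_simple by auto
    then show "\<exists>S\<subseteq>range atMost. countable S \<and> (UNIV :: real set) = \<Union> S"
      by (metis countable_image_eq countableI_type countable_image)
  qed (use I in auto)
  also have "{{f \<in> ?\<Omega>. \<forall>i\<in>j. f i \<in> A i} | A j. j \<in> {I} \<and> A \<in> Pi j (\<lambda>_. range atMost)} = range R"
  proof (intro equalityI subsetI)
    fix X assume "X \<in> {{f \<in> ?\<Omega>. \<forall>i\<in>j. f i \<in> A i} | A j. j \<in> {I} \<and> A \<in> Pi j (\<lambda>_. range atMost)}"
    then obtain A where X: "X = {f \<in> ?\<Omega>. \<forall>i\<in>I. f i \<in> A i}" and "A \<in> Pi I (\<lambda>_. range atMost)"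
      by blast
    then have "\<forall>i\<in>I. \<exists>a. A i = {..a}"
      by (auto simp: Pi_iff image_iff)
    then obtain a where "\<forall>i\<in>I. A i = {..a i}"
      by (rule bchoice[THEN exE])
    then have "X = R a"
      unfolding X R_def by auto
    then show "X \<in> range R" by simp
  next
    fix X assume "X \<in> range R"
    then obtain a where "X = R a" by auto
    then show "X \<in> {{f \<in> ?\<Omega>. \<forall>i\<in>j. f i \<in> A i} | A j. j \<in> {I} \<and> A \<in> Pi j (\<lambda>_. range atMost)}"
      by (auto simp: R_def intro!: exI[of _ "\<lambda>i. {..a i}"])
  qed
  also have "sets (sigma ?\<Omega> (range R)) = sigma_sets ?\<Omega> (range R)"
    by (rule sets_measure_of) (auto simp: R_def)
  finally have sets: "sets (PiM I (\<lambda>_. borel :: real measure)) = sigma_sets ?\<Omega> (range R)" .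
  show ?thesis
  proof (rule measure_eqI_generator_eq[of "range R" ?\<Omega> _ _ "\<lambda>n. R (\<lambda>_. real n)"])
    have "R a \<inter> R b = R (\<lambda>i. min (a i) (b i))" for a b
      by (auto simp: R_def)
    then show "Int_stable (range R)"
      by (auto simp: Int_stable_def)
    show "(\<Union>n. R (\<lambda>_. real n)) = ?\<Omega>"
    proof (intro equalityI subsetI)
      fix f assume f: "f \<in> ?\<Omega>"
      obtain n :: nat where "Max (insert 0 (f ` I)) \<le> real n"
        using real_arch_simple by blast
      then have "f \<in> R (\<lambda>_. real n)"
        using I f by (simp add: R_def)
      then show "f \<in> (\<Union>n. R (\<lambda>_. real n))" by blast
    qed (auto simp: R_def)
    show "emeasure \<mu> (R (\<lambda>_. real n)) \<noteq> \<infinity>" for n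
      using finite_measure.emeasure_finite[OF fin] by simp
  qed (use eq in \<open>auto simp: R_def \<mu> \<nu> sets\<close>)
qed

text \<open>Each ramp equals 1 up to and including \<open>a i\<close> and falls to 0 with slope
  \<open>k\<close> beyond it, so the products converge pointwise to the indicator of the closed
  orthant; they are dominated by 1.\<close>

lemma (in prob_space) expectation_prod_ramp_tendsto:
  fixes X :: "'i \<Rightarrow> 'a \<Rightarrow> real"
  assumes I: "finite I" and X: "\<And>i. i \<in> I \<Longrightarrow> X i \<in> borel_measurable M"
  shows "(\<lambda>k. expectation (\<lambda>\<omega>. \<Prod>i\<in>I. max 0 (min 1 (1 - real k * (X i \<omega> - a i))))) \<longlonglongrightarrow>
    prob {\<omega> \<in> space M. \<forall>i\<in>I. X i \<omega> \<le> a i}"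
proof -
  let ?S = "{\<omega> \<in> space M. \<forall>i\<in>I. X i \<omega> \<le> a i}"
  have S: "?S \<in> events"
    using I X by measurable
  have ramp: "(\<lambda>k. max 0 (min 1 (1 - real k * (x - b)))) \<longlonglongrightarrow> indicator {..b} x" for x b :: real
  proof (cases "x \<le> b")
    case True
    then have "max 0 (min 1 (1 - real k * (x - b))) = 1" for k
      using mult_nonneg_nonpos[of "real k" "x - b"] by simp
    then show ?thesis using True by simp
  next
    case False
    obtain k0 :: nat where k0: "1 / (x - b) \<le> real k0"
      using real_arch_simple by blast
    have "max 0 (min 1 (1 - real k * (x - b))) = 0" if "k \<ge> k0" for k
    proof -
      have "1 / (x - b) \<le> real k" using k0 that by linarith
      then have "1 \<le> real k * (x - b)" using False by (simp add: divide_le_eq)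
      then show ?thesis by simp
    qed
    then have "eventually (\<lambda>k. max 0 (min 1 (1 - real k * (x - b))) = 0) sequentially"
      unfolding eventually_sequentially by blast
    then show ?thesis using False by (simp add: tendsto_eventually)
  qed
  have "(\<lambda>k. expectation (\<lambda>\<omega>. \<Prod>i\<in>I. max 0 (min 1 (1 - real k * (X i \<omega> - a i))))) \<longlonglongrightarrow>
      expectation (indicator ?S)"
  proof (rule integral_dominated_convergence[where w="\<lambda>_. 1"])
    show "AE \<omega> in M. (\<lambda>k. \<Prod>i\<in>I. max 0 (min 1 (1 - real k * (X i \<omega> - a i)))) \<longlonglongrightarrow> indicator ?S \<omega>"
    proof (rule AE_I2)
      fix \<omega> assume \<omega>: "\<omega> \<in> space M"
      have "(\<lambda>k. \<Prod>i\<in>I. max 0 (min 1 (1 - real k * (X i \<omega> - a i)))) \<longlonglongrightarrow>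
          (\<Prod>i\<in>I. indicator {..a i} (X i \<omega>))"
        by (intro tendsto_prod ramp)
      also have "(\<Prod>i\<in>I. indicator {..a i} (X i \<omega>)) = (indicator ?S \<omega> :: real)"
        using I \<omega> by (auto simp: indicator_def prod_zero_iff)
      finally show "(\<lambda>k. \<Prod>i\<in>I. max 0 (min 1 (1 - real k * (X i \<omega> - a i)))) \<longlonglongrightarrow> indicator ?S \<omega>" .
    qed
    show "AE \<omega> in M. norm (\<Prod>i\<in>I. max 0 (min 1 (1 - real k * (X i \<omega> - a i)))) \<le> 1" for k
      by (intro AE_I2) (auto simp: abs_prod intro!: prod_le_1)
    show "(\<lambda>\<omega>. \<Prod>i\<in>I. max 0 (min 1 (1 - real k * (X i \<omega> - a i)))) \<in> borel_measurable M" for k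
      using X by (intro borel_measurable_prod borel_measurable_max borel_measurable_min
          borel_measurable_diff borel_measurable_times borel_measurable_const) auto
  qed (use S in auto)
  then show ?thesis
    using S by simp
qed

text \<open>The ramps are admissible test functions, and their limits give equal probabilities of
  all lower orthants.\<close>

lemma distr_PiM_eqI_continuous:
  fixes X :: "'i \<Rightarrow> 'a \<Rightarrow> real" and Y :: "'i \<Rightarrow> 'b \<Rightarrow> real"
  assumes M: "prob_space M" and N: "prob_space N" and I: "finite I"
    and X: "\<And>i. i \<in> I \<Longrightarrow> X i \<in> borel_measurable M" and Y: "\<And>i. i \<in> I \<Longrightarrow> Y i \<in> borel_measurable N"
    and eq: "\<And>g :: 'i \<Rightarrow> real \<Rightarrow> real. (\<And>i. continuous_on UNIV (g i)) \<Longrightarrow>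
      (\<And>i x. 0 \<le> g i x) \<Longrightarrow> (\<And>i x. g i x \<le> 1) \<Longrightarrow>
      (\<integral>\<omega>. (\<Prod>i\<in>I. g i (X i \<omega>)) \<partial>M) = (\<integral>\<omega>. (\<Prod>i\<in>I. g i (Y i \<omega>)) \<partial>N)"
  shows "distr M (PiM I (\<lambda>_. borel)) (\<lambda>\<omega>. \<lambda>i\<in>I. X i \<omega>) =
    distr N (PiM I (\<lambda>_. borel)) (\<lambda>\<omega>. \<lambda>i\<in>I. Y i \<omega>)"
proof -
  interpret M: prob_space M by (rule M)
  interpret N: prob_space N by (rule N)
  have X': "(\<lambda>\<omega>. \<lambda>i\<in>I. X i \<omega>) \<in> M \<rightarrow>\<^sub>M PiM I (\<lambda>_. borel)"
    using X by (intro measurable_restrict) auto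
  have Y': "(\<lambda>\<omega>. \<lambda>i\<in>I. Y i \<omega>) \<in> N \<rightarrow>\<^sub>M PiM I (\<lambda>_. borel)"
    using Y by (intro measurable_restrict) auto
  show ?thesis
  proof (rule measure_eqI_PiM_atMost[OF I])
    show "finite_measure (distr M (PiM I (\<lambda>_. borel)) (\<lambda>\<omega>. \<lambda>i\<in>I. X i \<omega>))"
      using X' by (rule M.finite_measure_distr)
    fix a :: "'i \<Rightarrow> real"
    let ?R = "{f \<in> PiE I (\<lambda>_. UNIV). \<forall>i\<in>I. f i \<le> a i}"
    have "?R = PiE I (\<lambda>i. {..a i})"
      by (auto simp: PiE_def)
    then have R: "?R \<in> sets (PiM I (\<lambda>_. borel))"
      using I by (auto intro: sets_PiM_I_finite)
    have ramp_eq: "(\<integral>\<omega>. (\<Prod>i\<in>I. max 0 (min 1 (1 - real k * (X i \<omega> - a i)))) \<partial>M) =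
        (\<integral>\<omega>. (\<Prod>i\<in>I. max 0 (min 1 (1 - real k * (Y i \<omega> - a i)))) \<partial>N)" for k :: nat
    proof (rule eq)
      show "continuous_on UNIV (\<lambda>x. max 0 (min 1 (1 - real k * (x - a i))))" for i
        by (intro continuous_intros)
    qed auto
    have prob_eq: "measure M {\<omega> \<in> space M. \<forall>i\<in>I. X i \<omega> \<le> a i} = measure N {\<omega> \<in> space N. \<forall>i\<in>I. Y i \<omega> \<le> a i}"
      using M.expectation_prod_ramp_tendsto[where X=X and a=a, OF I X] N.expectation_prod_ramp_tendsto[where X=Y and a=a, OF I Y]
      unfolding ramp_eq by (rule LIMSEQ_unique)
    have "emeasure (distr M (PiM I (\<lambda>_. borel)) (\<lambda>\<omega>. \<lambda>i\<in>I. X i \<omega>)) ?R =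
        emeasure M {\<omega> \<in> space M. \<forall>i\<in>I. X i \<omega> \<le> a i}"
      using X' R by (subst emeasure_distr) (auto intro!: arg_cong[where f="emeasure M"])
    also have "\<dots> = emeasure N {\<omega> \<in> space N. \<forall>i\<in>I. Y i \<omega> \<le> a i}"
      using prob_eq by (simp add: M.emeasure_eq_measure N.emeasure_eq_measure)
    also have "\<dots> = emeasure (distr N (PiM I (\<lambda>_. borel)) (\<lambda>\<omega>. \<lambda>i\<in>I. Y i \<omega>)) ?R"
      using Y' R by (subst emeasure_distr) (auto intro!: arg_cong[where f="emeasure N"])
    finally show "emeasure (distr M (PiM I (\<lambda>_. borel)) (\<lambda>\<omega>. \<lambda>i\<in>I. X i \<omega>)) ?R =
      emeasure (distr N (PiM I (\<lambda>_. borel)) (\<lambda>\<omega>. \<lambda>i\<in>I. Y i \<omega>)) ?R" .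
  qed simp_all
qed

text \<open>The power is at most \<open>exp (420 * t\<^sup>2 / n)\<close>: an error of order
  \<open>h\<^sup>2\<close> per step, over \<open>n = t / h\<close> steps, still vanishes.\<close>

lemma error_bound_tendsto:
  fixes t :: real
  shows "(\<lambda>n. sqrt ((1 + 420 * (t / n)\<^sup>2) ^ n - 1)) \<longlonglongrightarrow> 0"
proof -
  have bounds: "eventually (\<lambda>n. 0 \<le> (1 + 420 * (t / n)\<^sup>2) ^ n - 1) sequentially"
      "eventually (\<lambda>n. (1 + 420 * (t / n)\<^sup>2) ^ n - 1 \<le> exp (420 * t\<^sup>2 / n) - 1) sequentially"
  proof -
    show "eventually (\<lambda>n. 0 \<le> (1 + 420 * (t / n)\<^sup>2) ^ n - 1) sequentially"
      by (intro always_eventually) simp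
    show "eventually (\<lambda>n. (1 + 420 * (t / n)\<^sup>2) ^ n - 1 \<le> exp (420 * t\<^sup>2 / n) - 1) sequentially"
      using eventually_gt_at_top[of 0]
    proof eventually_elim
      case (elim n)
      have "(1 + 420 * (t / n)\<^sup>2) ^ n \<le> exp (420 * (t / n)\<^sup>2) ^ n"
        by (intro power_mono exp_ge_add_one_self) simp
      also have "\<dots> = exp (420 * t\<^sup>2 / n)"
        using elim by (simp add: power2_eq_square flip: exp_of_nat_mult)
      finally show ?case by simp
    qed
  qed
  have "(\<lambda>n. exp (420 * t\<^sup>2 / real n) - 1) \<longlonglongrightarrow> exp 0 - 1"
    by (intro tendsto_intros lim_const_over_n)
  then have "(\<lambda>n. exp (420 * t\<^sup>2 / real n) - 1) \<longlonglongrightarrow> 0"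
    by simp
  from tendsto_sandwich[OF bounds tendsto_const this]
  have "(\<lambda>n. (1 + 420 * (t / n)\<^sup>2) ^ n - 1) \<longlonglongrightarrow> 0" .
  from tendsto_real_sqrt[OF this] show ?thesis
    by simp
qed

theorem theorem1p1:
  fixes M :: "'a measure" and B :: "real \<Rightarrow> 'a \<Rightarrow> real" and t :: real
  assumes "std_BM M B" and "t > 0"
  shows "fdd_eq M (\<lambda>s \<omega>. calT t (\<lambda>u. B u \<omega>) s) M B {0..t}"
  unfolding fdd_eq_def
proof (intro allI impI)
  fix ts assume ts: "set ts \<subseteq> {0..t}"
  interpret prob_space M
    using assms(1) by (simp add: std_BM_def)
  define V where "V n = grid B n (t / n)" for n
  have paths: "continuous_on {0..t} (\<lambda>u. B u \<omega>)" "B 0 \<omega> = 0" if "\<omega> \<in> space M" for \<omega>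
    using assms(1) that by (auto simp: std_BM_def intro: continuous_on_subset)
  have V_meas: "V n \<in> M \<rightarrow>\<^sub>M leb n" if "n > 0" for n
    unfolding V_def using assms that by (intro grid_measurable) auto
  \<comment> \<open>Grids are indexed by \<open>Suc n\<close>, which keeps the number of points
    positive for every \<open>n\<close>.\<close>
  have V_lim: "(\<lambda>n. V (Suc n) \<omega> (grid_index t (Suc n) s)) \<longlonglongrightarrow> B s \<omega>"
    and T_lim: "(\<lambda>n. dT (Suc n) (t / Suc n) (V (Suc n) \<omega>) (grid_index t (Suc n) s)) \<longlonglongrightarrow> calT t (\<lambda>u. B u \<omega>) s"
    if "\<omega> \<in> space M" "s \<in> {0..t}" for \<omega> s
    using LIMSEQ_Suc[OF samples_tendsto[OF paths[OF that(1)] assms(2), of s]]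
      LIMSEQ_Suc[OF dT_tendsto[OF paths[OF that(1)] assms(2), of s]] that(2)
    unfolding V_def grid_def by auto
  have comp: "(\<lambda>v. v (grid_index t (Suc n) s)) \<in> borel_measurable (leb (Suc n))" for n s
    by (intro leb_component grid_index_less) simp
  have V_comp: "(\<lambda>\<omega>. V (Suc n) \<omega> (grid_index t (Suc n) s)) \<in> borel_measurable M" for n s
    using measurable_compose[OF V_meas comp] by simp
  have T_comp: "(\<lambda>\<omega>. dT (Suc n) (t / Suc n) (V (Suc n) \<omega>) (grid_index t (Suc n) s)) \<in> borel_measurable M" for n s
    using measurable_compose[OF measurable_compose[OF V_meas dT_measurable] comp] by simp
  have B_meas: "B s \<in> borel_measurable M" if s: "s \<in> {0..t}" for s
  proof (rule borel_measurable_LIMSEQ_real)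
    show "(\<lambda>n. V (Suc n) \<omega> (grid_index t (Suc n) s)) \<longlonglongrightarrow> B s \<omega>" if "\<omega> \<in> space M" for \<omega>
      using that s by (rule V_lim)
  qed (rule V_comp)
  \<comment> \<open>The transformed path contains a pathwise time integral; its measurability comes
    from its being a limit of measurable discrete transforms.\<close>
  have T_meas: "(\<lambda>\<omega>. calT t (\<lambda>u. B u \<omega>) s) \<in> borel_measurable M" if s: "s \<in> {0..t}" for s
  proof (rule borel_measurable_LIMSEQ_real)
    show "(\<lambda>n. dT (Suc n) (t / Suc n) (V (Suc n) \<omega>) (grid_index t (Suc n) s)) \<longlonglongrightarrow>
        calT t (\<lambda>u. B u \<omega>) s" if "\<omega> \<in> space M" for \<omega>
      using that s by (rule T_lim)
  qed (rule T_comp)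
  let ?I = "{..<length ts}"
  have ts_nth: "ts ! i \<in> {0..t}" if "i \<in> ?I" for i
    using ts that nth_mem by blast
  show "distr M (\<Pi>\<^sub>M i\<in>?I. borel) (\<lambda>\<omega>. \<lambda>i\<in>?I. calT t (\<lambda>u. B u \<omega>) (ts ! i)) =
      distr M (\<Pi>\<^sub>M i\<in>?I. borel) (\<lambda>\<omega>. \<lambda>i\<in>?I. B (ts ! i) \<omega>)"
  proof (rule distr_PiM_eqI_continuous)
    fix g :: "nat \<Rightarrow> real \<Rightarrow> real"
    assume g: "\<And>i. continuous_on UNIV (g i)" and g0: "\<And>i x. 0 \<le> g i x" and g1: "\<And>i x. g i x \<le> 1"
    have g_meas: "g i \<in> borel_measurable borel" for i
      using g by (rule borel_measurable_continuous_onI)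
    have g_lim: "(\<lambda>n. g i (x n)) \<longlonglongrightarrow> g i y" if "x \<longlonglongrightarrow> y" for i x y
      using continuous_on_tendsto_compose[OF g that] by simp
    define G where "G n v = (\<Prod>i\<in>?I. g i (v (grid_index t (Suc n) (ts ! i))))" for n v
    have G01: "0 \<le> G n v" "G n v \<le> 1" for n v
      unfolding G_def using g0 g1 by (auto intro!: prod_nonneg prod_le_1)
    have G_meas: "G n \<in> borel_measurable (leb (Suc n))" for n
      unfolding G_def by (intro borel_measurable_prod measurable_compose[OF comp g_meas])
    have lim1: "(\<lambda>n. expectation (\<lambda>\<omega>. G n (V (Suc n) \<omega>))) \<longlonglongrightarrow>
        expectation (\<lambda>\<omega>. \<Prod>i\<in>?I. g i (B (ts ! i) \<omega>))"
    proof (rule integral_dominated_convergence[where w="\<lambda>_. 1"])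
      show "AE \<omega> in M. (\<lambda>n. G n (V (Suc n) \<omega>)) \<longlonglongrightarrow> (\<Prod>i\<in>?I. g i (B (ts ! i) \<omega>))"
        unfolding G_def by (intro AE_I2 tendsto_prod g_lim V_lim ts_nth)
      show "(\<lambda>\<omega>. \<Prod>i\<in>?I. g i (B (ts ! i) \<omega>)) \<in> borel_measurable M"
        by (intro borel_measurable_prod measurable_compose[OF B_meas g_meas] ts_nth)
      show "(\<lambda>\<omega>. G n (V (Suc n) \<omega>)) \<in> borel_measurable M" for n
        using measurable_compose[OF V_meas G_meas] by simp
    qed (use G01 in auto)
    have lim2: "(\<lambda>n. expectation (\<lambda>\<omega>. G n (dT (Suc n) (t / Suc n) (V (Suc n) \<omega>)))) \<longlonglongrightarrow>
        expectation (\<lambda>\<omega>. \<Prod>i\<in>?I. g i (calT t (\<lambda>u. B u \<omega>) (ts ! i)))"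
    proof (rule integral_dominated_convergence[where w="\<lambda>_. 1"])
      show "AE \<omega> in M. (\<lambda>n. G n (dT (Suc n) (t / Suc n) (V (Suc n) \<omega>))) \<longlonglongrightarrow>
          (\<Prod>i\<in>?I. g i (calT t (\<lambda>u. B u \<omega>) (ts ! i)))"
        unfolding G_def by (intro AE_I2 tendsto_prod g_lim T_lim ts_nth)
      show "(\<lambda>\<omega>. \<Prod>i\<in>?I. g i (calT t (\<lambda>u. B u \<omega>) (ts ! i))) \<in> borel_measurable M"
        by (intro borel_measurable_prod measurable_compose[OF T_meas g_meas] ts_nth)
      show "(\<lambda>\<omega>. G n (dT (Suc n) (t / Suc n) (V (Suc n) \<omega>))) \<in> borel_measurable M" for n
        using measurable_compose[OF measurable_compose[OF V_meas dT_measurable] G_meas] by simp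
    qed (use G01 in auto)
    \<comment> \<open>For large \<open>n\<close> the mesh falls below the threshold required by
      \<open>expectation_dT_approx\<close>.\<close>
    have "eventually (\<lambda>n. t / real (Suc n) < 1 / 6) sequentially"
      using LIMSEQ_Suc[OF lim_const_over_n[of t]] by (intro order_tendstoD) auto
    then have "eventually (\<lambda>n. norm (expectation (\<lambda>\<omega>. G n (dT (Suc n) (t / Suc n) (V (Suc n) \<omega>))) -
        expectation (\<lambda>\<omega>. G n (V (Suc n) \<omega>))) \<le> sqrt ((1 + 420 * (t / Suc n)\<^sup>2) ^ Suc n - 1)) sequentially"
    proof eventually_elim
      case (elim n)
      then show ?case
        unfolding real_norm_def V_def using assms G_meas G01
        by (intro expectation_dT_approx) auto
    qed
    then have "(\<lambda>n. expectation (\<lambda>\<omega>. G n (dT (Suc n) (t / Suc n) (V (Suc n) \<omega>))) -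
        expectation (\<lambda>\<omega>. G n (V (Suc n) \<omega>))) \<longlonglongrightarrow> 0"
      using LIMSEQ_Suc[OF error_bound_tendsto[of t]] by (rule Lim_null_comparison)
    \<comment> \<open>The difference of discrete expectations tends both to the difference of the
      limits and to 0.\<close>
    with tendsto_diff[OF lim2 lim1] have
      "expectation (\<lambda>\<omega>. \<Prod>i\<in>?I. g i (calT t (\<lambda>u. B u \<omega>) (ts ! i))) -
        expectation (\<lambda>\<omega>. \<Prod>i\<in>?I. g i (B (ts ! i) \<omega>)) = 0"
      by (rule LIMSEQ_unique)
    then show "expectation (\<lambda>\<omega>. \<Prod>i\<in>?I. g i (calT t (\<lambda>u. B u \<omega>) (ts ! i))) =
        expectation (\<lambda>\<omega>. \<Prod>i\<in>?I. g i (B (ts ! i) \<omega>))"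
      by simp
  qed (use B_meas T_meas ts_nth in \<open>auto intro: prob_space_axioms\<close>)
qed

end
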